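(* Let $q\ge1$ be real, ${\sf m}=(m_1,\dots,m_\ell)$ a tuple of positive integers with sum $n$, and $\overline{x}_1,\dots,\overline{x}_\ell$ positive reals with sum $1$. For each weak composition ${\sf a}=(a_1,\dots,a_\ell)$ with $0\le a_j\le m_j$ (equivalently, each upper set $S_{\sf a}$ of $P_{\sf m}$), let \[ \lambda_{\sf a}(q,\overline{{\sf x}})=\sum_{j=1}^\ell\overline{x}_j\frac{q^{a_{j+1}+\cdots+a_\ell}[a_j]_q}{q^{n-n_j}[m_j]_q}. \] Then the eigenvalues of the transition matrix of the $q$-Tsetlin library $\mathcal{T}_{W_{\sf m}}(q,\overline{{\sf x}})$ on $W_{\sf m}$ are the $\lambda_{\sf a}(q,\overline{{\sf x}})$, where $\lambda_{\sf a}(q,\overline{{\sf x}})$ occurs with multiplicity $d_{P_{\sf m}\setminus S_{\sf a}}$; i.e. the characteristic polynomial is $\prod_{\sf a}(t-\lambda_{\sf a}(q,\overline{{\sf x}}))^{d_{P_{\sf m}\setminus S_{\sf a}}}$.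
   Context: $W_{\sf m}$ is the set of words of length $n$ in $\{1,\dots,\ell\}$ with $m_j$ copies of letter $j$. Hecke generators act on the real vector space with basis $W_{\sf m}$ on the right by $w\cdot T_i=q\,ws_i$ if $w_{i+1}\le w_i$ and $w\cdot T_i=ws_i+(q-1)w$ if $w_{i+1}>w_i$, where $ws_i$ swaps positions $i,i+1$. With $[m]_q=1+q+\cdots+q^{m-1}$, let $w\cdot\mathcal{X}=\frac{\overline{x}_{w_1}}{q^{m_{w_1+1}+\cdots+m_\ell}[m_{w_1}]_q}w$ and $\mathcal{T}_{W_{\sf m}}(q,\overline{{\sf x}})=\sum_{i=1}^nT_{i-1}\cdots T_1\mathcal{X}$ acting on the right (apply $T_{i-1}$ first, …, $T_1$, then $\mathcal{X}$; the $i=1$ term is $\mathcal{X}$). Let $n_j=m_1+\cdots+m_j$ ($n_0=0$) and $M_j=\{n_{j-1}+1,\dots,n_j\}$. $P_{\sf m}$ is the poset on $[n]$ which is a disjoint union of $\ell$ chains, the $j$-th chain being $n_{j-1}+1<n_{j-1}+2<\cdots<n_j$. The upper set $S_{\sf a}$ consists of the top $a_j$ elements of the $j$-th chain for each $j$. For a finite poset $P$ whose elements are labeled by integers, relabel its elements $1,\dots,|P|$ in increasing order of labels; a linear extension is a word $\pi_1\cdots\pi_{|P|}$ listing all elements (by these labels) such that each element appears after all elements below it; it is a poset derangement if $\pi_i\ne i$ for all $i$. $d_P$ is the number of poset derangements of $P$ (e.g. $d_{P_{(2,2)}}=2$, given by $3142$ and $3412$). *)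

theory Defs
  imports "Jordan_Normal_Form.Char_Poly"
begin

text \<open>
  Compositions \<open>m\<close>, \<open>a\<close> and the weights \<open>x\<close> are functions on \<open>nat\<close> of which only the
  arguments \<open>1, \<dots>, l\<close> matter.  A word \<open>w = w\<^sub>1\<dots>w\<^sub>n\<close> is a list, so \<open>w\<^sub>i\<close> is \<open>w ! (i - 1)\<close>.
\<close>

definition qint :: "real \<Rightarrow> nat \<Rightarrow> real" where
  "qint q k = (\<Sum>i<k. q ^ i)"

definition words :: "nat \<Rightarrow> (nat \<Rightarrow> nat) \<Rightarrow> nat list set" where
  "words l m = {w. length w = (\<Sum>j=1..l. m j) \<and> set w \<subseteq> {1..l} \<and>
                   (\<forall>j\<in>{1..l}. count_list w j = m j)}"

text \<open>
  A vector of the space with basis \<open>W\<close> is its coefficient function on \<open>W\<close> (values off \<open>W\<close> are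
  ignored).  \<open>lin_ext W f\<close> is the linear map taking each basis element \<open>w\<close> to \<open>f w\<close>.
\<close>

definition basis_vec :: "'w \<Rightarrow> 'w \<Rightarrow> real" where
  "basis_vec w = (\<lambda>u. if u = w then 1 else 0)"

definition lin_ext :: "'w set \<Rightarrow> ('w \<Rightarrow> 'w \<Rightarrow> real) \<Rightarrow> ('w \<Rightarrow> real) \<Rightarrow> 'w \<Rightarrow> real" where
  "lin_ext W f v = (\<lambda>u. \<Sum>w\<in>W. v w * f w u)"

definition swap_at :: "nat \<Rightarrow> 'b list \<Rightarrow> 'b list" where
  "swap_at i w = w[i - 1 := w ! i, i := w ! (i - 1)]"

definition hecke :: "nat list set \<Rightarrow> real \<Rightarrow> nat \<Rightarrow> (nat list \<Rightarrow> real) \<Rightarrow> nat list \<Rightarrow> real" where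
  "hecke W q i = lin_ext W (\<lambda>w.
     if w ! i \<le> w ! (i - 1)
     then (\<lambda>u. q * basis_vec (swap_at i w) u)
     else (\<lambda>u. basis_vec (swap_at i w) u + (q - 1) * basis_vec w u))"

definition weight_op ::
  "nat \<Rightarrow> (nat \<Rightarrow> nat) \<Rightarrow> real \<Rightarrow> (nat \<Rightarrow> real) \<Rightarrow> (nat list \<Rightarrow> real) \<Rightarrow> nat list \<Rightarrow> real" where
  "weight_op l m q x = lin_ext (words l m) (\<lambda>w.
     (\<lambda>u. x (w ! 0) / (q ^ (\<Sum>k=w ! 0 + 1..l. m k) * qint q (m (w ! 0))) * basis_vec w u))"

text \<open>
  The operators act on the right: \<open>v \<cdot> T\<^bsub>i-1\<^esub>\<dots>T\<^sub>1\<X>\<close> applies \<open>T\<^bsub>i-1\<^esub>\<close> first and \<open>\<X>\<close> last, whence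
  the fold over \<open>[i - 1, \<dots>, 1]\<close>.
\<close>

definition tsetlin ::
  "nat \<Rightarrow> (nat \<Rightarrow> nat) \<Rightarrow> real \<Rightarrow> (nat \<Rightarrow> real) \<Rightarrow> (nat list \<Rightarrow> real) \<Rightarrow> nat list \<Rightarrow> real" where
  "tsetlin l m q x v = (\<lambda>u. \<Sum>i=1..(\<Sum>j=1..l. m j).
     weight_op l m q x (fold (hecke (words l m) q) (rev [1..<i]) v) u)"

text \<open>The rows and columns are indexed by an enumeration \<open>ws\<close> of the words.\<close>

definition transition_matrix ::
  "nat \<Rightarrow> (nat \<Rightarrow> nat) \<Rightarrow> real \<Rightarrow> (nat \<Rightarrow> real) \<Rightarrow> nat list list \<Rightarrow> real mat" where
  "transition_matrix l m q x ws =
     mat (length ws) (length ws) (\<lambda>(r, c). tsetlin l m q x (basis_vec (ws ! r)) (ws ! c))"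

text \<open>
  A finite poset labeled by integers is a carrier set \<open>A\<close> of labels with a reflexive order
  relation \<open>r\<close>; only the part of \<open>r\<close> inside \<open>A\<close> is used, so subposets of \<open>(A, r)\<close> need no
  restriction of \<open>r\<close>.
\<close>

definition relabel :: "nat set \<Rightarrow> nat \<Rightarrow> nat" where
  "relabel A p = card {y \<in> A. y \<le> p}"

definition relabeled_order :: "nat set \<Rightarrow> nat rel \<Rightarrow> nat rel" where
  "relabeled_order A r = {(relabel A x, relabel A y) | x y. x \<in> A \<and> y \<in> A \<and> (x, y) \<in> r}"

definition linear_extensions :: "nat set \<Rightarrow> nat rel \<Rightarrow> nat list set" where
  "linear_extensions A r = {\<pi>. distinct \<pi> \<and> set \<pi> = {1..card A} \<and>
     (\<forall>i<length \<pi>. \<forall>k<length \<pi>. (\<pi> ! i, \<pi> ! k) \<in> relabeled_order A r \<longrightarrow> i \<le> k)}"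

definition poset_derangements :: "nat set \<Rightarrow> nat rel \<Rightarrow> nat list set" where
  "poset_derangements A r =
     {\<pi> \<in> linear_extensions A r. \<forall>i\<in>{1..length \<pi>}. \<pi> ! (i - 1) \<noteq> i}"

definition partial_sum :: "(nat \<Rightarrow> nat) \<Rightarrow> nat \<Rightarrow> nat" where
  "partial_sum m j = (\<Sum>k=1..j. m k)"

definition chain_block :: "(nat \<Rightarrow> nat) \<Rightarrow> nat \<Rightarrow> nat set" where
  "chain_block m j = {partial_sum m (j - 1) + 1..partial_sum m j}"

definition chains_order :: "nat \<Rightarrow> (nat \<Rightarrow> nat) \<Rightarrow> nat rel" where
  "chains_order l m =
     {(x, y). x \<le> y \<and> (\<exists>j\<in>{1..l}. x \<in> chain_block m j \<and> y \<in> chain_block m j)}"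

definition upper_set :: "nat \<Rightarrow> (nat \<Rightarrow> nat) \<Rightarrow> (nat \<Rightarrow> nat) \<Rightarrow> nat set" where
  "upper_set l m a = (\<Union>j\<in>{1..l}. {partial_sum m j - a j + 1..partial_sum m j})"

definition eigval ::
  "nat \<Rightarrow> (nat \<Rightarrow> nat) \<Rightarrow> real \<Rightarrow> (nat \<Rightarrow> real) \<Rightarrow> (nat \<Rightarrow> nat) \<Rightarrow> real" where
  "eigval l m q x a = (\<Sum>j=1..l. x j *
     (q ^ (\<Sum>k=j+1..l. a k) * qint q (a j) /
      (q ^ (partial_sum m l - partial_sum m j) * qint q (m j))))"

end

theory Submission
  imports Defs
begin

text \<open>
  Let \<open>(d\<^sub>k v)(u)\<close> be the coefficient of \<open>v \<cdot> \<Sum>\<^sub>i T\<^bsub>i-1\<^esub>\<dots>T\<^sub>1\<close> at \<open>k u\<close>, so that the Tsetlin library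
  is \<open>(T\<^sub>y v)(k u) = y\<^sub>k (d\<^sub>k v)(u)\<close>, where \<open>y\<close> may be arbitrary.  The braid relations give
  \<open>d\<^sub>k d\<^sub>j = q d\<^sub>j d\<^sub>k\<close> for \<open>j < k\<close> and \<open>d\<^sub>k T\<^sub>y = (y\<^sub>k + T\<^bsub>y'\<^esub>) d\<^sub>k\<close> with new weights \<open>y'\<close>.  On the words of
  content \<open>M\<close>, filter by the joint kernels \<open>K\<^sub>J(M)\<close> of the \<open>d\<^sub>j\<close>, \<open>j \<in> J\<close>: the map \<open>d\<^sub>k\<close> sends \<open>K\<^sub>J(M)\<close> onto
  \<open>K\<^sub>J(M - k)\<close> with kernel \<open>K\<^bsub>J+k\<^esub>(M)\<close>.  Surjectivity holds because prepending \<open>k\<close>, followed by \<open>d\<^sub>k\<close>, is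
  \<open>1 + T\<^sub>z\<close> with \<open>z \<ge> 0\<close>, whose eigenvalues are positive by induction.  Hence \<open>T\<^sub>y\<close> is triangularisable,
  with one eigenvalue for each submultiset \<open>A\<close> of \<open>M\<close>, of multiplicity the dimension of the joint
  kernel of all \<open>d\<^sub>j\<close> on content \<open>M - A\<close>.  The words of content \<open>M\<close> in which no letter of \<open>J\<close> is fixed by
  the standardisation satisfy the same recursion as \<open>dim K\<^sub>J(M)\<close>, and for \<open>J\<close> the set of all letters
  they correspond to the poset derangements.
\<close>

section \<open>Triangularising flags\<close>

definition lin_map :: "(('a \<Rightarrow> real) \<Rightarrow> 'b \<Rightarrow> real) \<Rightarrow> bool" where
  "lin_map T \<longleftrightarrow> (\<forall>f g c. T (\<lambda>u. f u + c * g u) = (\<lambda>u. T f u + c * T g u))"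

definition subsp :: "('a \<Rightarrow> real) set \<Rightarrow> bool" where
  "subsp V \<longleftrightarrow> (\<lambda>_. 0) \<in> V \<and> (\<forall>f\<in>V. \<forall>g\<in>V. \<forall>c. (\<lambda>u. f u + c * g u) \<in> V)"

text \<open>
  \<open>L\<close> is the multiset of eigenvalues of \<open>T\<close> on the finite-dimensional space \<open>U\<close>; function types are
  not in the class \<open>real_vector\<close>, hence the pointwise formulation.
\<close>

inductive flag :: "(('a \<Rightarrow> real) \<Rightarrow> 'a \<Rightarrow> real) \<Rightarrow> ('a \<Rightarrow> real) set \<Rightarrow> real multiset \<Rightarrow> bool" for T where
  flag_zero: "flag T {\<lambda>_. 0} {#}"
| flag_step: "flag T U L \<Longrightarrow> v \<notin> U \<Longrightarrow> (\<lambda>x. T v x - c * v x) \<in> U \<Longrightarrow>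
    flag T {(\<lambda>x. u x + a * v x) | u a. u \<in> U} (add_mset c L)"

lemma lin_mapD: "lin_map T \<Longrightarrow> T (\<lambda>u. f u + c * g u) = (\<lambda>u. T f u + c * T g u)"
  by (simp add: lin_map_def)

lemma lin_map_zero: "lin_map T \<Longrightarrow> T (\<lambda>_. 0) = (\<lambda>_. 0)"
  using lin_mapD[of T "\<lambda>_. 0" "-1" "\<lambda>_. 0"] by simp

lemma subsp_zero: "subsp V \<Longrightarrow> (\<lambda>_. 0) \<in> V"
  by (simp add: subsp_def)

lemma subspD: "subsp V \<Longrightarrow> f \<in> V \<Longrightarrow> g \<in> V \<Longrightarrow> (\<lambda>u. f u + c * g u) \<in> V"
  by (simp add: subsp_def)

lemma subsp_diff: "subsp V \<Longrightarrow> f \<in> V \<Longrightarrow> g \<in> V \<Longrightarrow> (\<lambda>u. f u - c * g u) \<in> V"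
  using subspD[of V f g "- c"] by simp

lemma subsp_scale: "subsp V \<Longrightarrow> g \<in> V \<Longrightarrow> (\<lambda>u. c * g u) \<in> V"
  using subspD[of V "\<lambda>_. 0" g c] subsp_zero[of V] by simp

lemma flag_subsp: "flag T U L \<Longrightarrow> subsp U"
proof (induction rule: flag.induct)
  case flag_zero
  show ?case by (simp add: subsp_def)
next
  case (flag_step U L v c)
  show ?case unfolding subsp_def
  proof (intro conjI ballI allI)
    show "(\<lambda>_. 0) \<in> {(\<lambda>x. u x + a * v x) | u a. u \<in> U}"
      using subsp_zero[OF flag_step.IH] by (auto intro!: exI[of _ "\<lambda>_. 0"] exI[of _ 0])
  next
    fix f g d
    assume "f \<in> {(\<lambda>x. u x + a * v x) | u a. u \<in> U}" "g \<in> {(\<lambda>x. u x + a * v x) | u a. u \<in> U}"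
    then obtain u a u' a' where "f = (\<lambda>x. u x + a * v x)" "u \<in> U"
      "g = (\<lambda>x. u' x + a' * v x)" "u' \<in> U" by auto
    then show "(\<lambda>x. f x + d * g x) \<in> {(\<lambda>x. u x + a * v x) | u a. u \<in> U}"
      using subspD[OF flag_step.IH, of u u' d]
      by (auto simp: algebra_simps fun_eq_iff
          intro!: exI[of _ "\<lambda>x. u x + d * u' x"] exI[of _ "a + d * a'"])
  qed
qed

lemma flag_invariant:
  assumes "lin_map T" "flag T U L" "f \<in> U"
  shows "T f \<in> U"
  using assms(2,3)
proof (induction arbitrary: f rule: flag.induct)
  case flag_zero
  then show ?case using lin_map_zero[OF assms(1)] by simp
next
  case (flag_step U L v c)
  from flag_step.prems obtain u a where u: "f = (\<lambda>x. u x + a * v x)" "u \<in> U" by auto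
  have "T f = (\<lambda>x. (T u x + a * (T v x - c * v x)) + a * c * v x)"
    unfolding u(1) lin_mapD[OF assms(1)] by (simp add: algebra_simps)
  moreover have "(\<lambda>x. T u x + a * (T v x - c * v x)) \<in> U"
    using subspD[OF flag_subsp[OF flag_step.hyps(1)] flag_step.IH[OF u(2)] flag_step.hyps(3)] .
  ultimately show ?case
    by (intro CollectI exI[of _ "\<lambda>x. T u x + a * (T v x - c * v x)"] exI[of _ "a * c"]) simp
qed

text \<open>Spectra add up along the exact sequence of the kernel, \<open>V\<close> and the image.
  Induction on the flag of \<open>V'\<close>: the preimage \<open>V0\<close> of its lower space has
  a flag by induction, and any lift of the new vector extends it with the same eigenvalue
  \<open>c\<close>.\<close>

lemma flag_extend:
  assumes "lin_map T" "lin_map T'" "lin_map \<phi>"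
    and "flag T' V' L'" and U: "flag T {f \<in> V. \<phi> f = (\<lambda>_. 0)} L"
    and "subsp V" "\<phi> ` V = V'"
    and "\<And>f. f \<in> V \<Longrightarrow> T f \<in> V" "\<And>f. f \<in> V \<Longrightarrow> \<phi> (T f) = T' (\<phi> f)"
  shows "flag T V (L + L')"
  using assms(4-)
proof (induction arbitrary: V rule: flag.induct)
  case flag_zero
  then have "{f \<in> V. \<phi> f = (\<lambda>_. 0)} = V" by auto
  with flag_zero show ?case by simp
next
  case (flag_step U' L' v' c)
  note V = flag_step.prems(2) and sU' = flag_subsp[OF flag_step.hyps(1)]
  define V0 where "V0 = {f \<in> V. \<phi> f \<in> U'}"
  have "subsp V0" using V sU' unfolding V0_def subsp_def by (auto simp: lin_map_zero assms lin_mapD)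
  have U'V: "u \<in> \<phi> ` V" if "u \<in> U'" for u
    unfolding flag_step.prems(3) using that by (auto intro!: exI[of _ u] exI[of _ 0])
  have "{f \<in> V0. \<phi> f = (\<lambda>_. 0)} = {f \<in> V. \<phi> f = (\<lambda>_. 0)}"
    using subsp_zero[OF sU'] by (auto simp: V0_def)
  then have "flag T V0 (L + L')"
    using flag_step.prems \<open>subsp V0\<close> U'V
    by (intro flag_step.IH) (auto simp: V0_def flag_invariant[OF assms(2) flag_step.hyps(1)])
  moreover obtain v where v: "v \<in> V" "\<phi> v = v'"
  proof -
    have "v' \<in> \<phi> ` V" unfolding flag_step.prems(3)
      using subsp_zero[OF sU'] by (auto intro!: exI[of _ "\<lambda>_. 0"] exI[of _ 1])
    then show ?thesis using that by auto
  qed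
  moreover have "(\<lambda>x. T v x - c * v x) \<in> V0"
  proof -
    have "\<phi> (\<lambda>x. T v x - c * v x) = (\<lambda>x. T' v' x - c * v' x)"
      using lin_mapD[OF assms(3), of "T v" "- c" v] flag_step.prems(5)[OF v(1)] v(2) by simp
    then show ?thesis using subsp_diff[OF V] flag_step.prems(4) v flag_step.hyps(3)
      by (simp add: V0_def)
  qed
  moreover have "v \<notin> V0" using v flag_step.hyps by (simp add: V0_def)
  ultimately have "flag T {(\<lambda>x. u x + a * v x) | u a. u \<in> V0} (add_mset c (L + L'))"
    by (intro flag.flag_step)
  moreover have "{(\<lambda>x. u x + a * v x) | u a. u \<in> V0} = V"
  proof (intro equalityI subsetI)
    fix f assume f: "f \<in> V"
    then have "\<phi> f \<in> {(\<lambda>x. u x + a * v' x) | u a. u \<in> U'}" using flag_step.prems(3) by blast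
    then obtain u' a where u': "\<phi> f = (\<lambda>x. u' x + a * v' x)" "u' \<in> U'" by auto
    have "\<phi> (\<lambda>x. f x - a * v x) = u'"
      using lin_mapD[OF assms(3), of f "- a" v] v(2) u'(1) by simp
    then have "(\<lambda>x. f x - a * v x) \<in> V0"
      using u' f v subsp_diff[OF V] by (simp add: V0_def)
    then show "f \<in> {(\<lambda>x. u x + a * v x) | u a. u \<in> V0}"
      by (auto intro!: exI[of _ "\<lambda>x. f x - a * v x"] exI[of _ a])
  next
    fix f assume "f \<in> {(\<lambda>x. u x + a * v x) | u a. u \<in> V0}"
    then show "f \<in> V" using subspD[OF V] v by (auto simp: V0_def)
  qed
  ultimately show ?case by simp
qed

lemma flag_shift:
  assumes "flag T U L"
  shows "flag (\<lambda>f x. d * f x + T f x) U (image_mset ((+) d) L)"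
  using assms
proof (induction rule: flag.induct)
  case flag_zero
  show ?case by (auto intro: flag.intros)
next
  case (flag_step U L v c)
  then show ?case
    using flag.flag_step[OF flag_step.IH flag_step.hyps(2), of "d + c"] by (simp add: algebra_simps)
qed

text \<open>Back substitution along the flag: the top coefficient is divided by
  \<open>1 + c\<close>, and what remains lies in the smaller space. This will supply preimages under
  \<open>d_k\<close>.\<close>

lemma flag_solve:
  assumes "lin_map T" "flag T U L" "\<And>c. c \<in># L \<Longrightarrow> c \<noteq> -1" "f \<in> U"
  obtains s where "s \<in> U" "(\<lambda>x. s x + T s x) = f"
proof -
  have "\<exists>s\<in>U. (\<lambda>x. s x + T s x) = f"
    using assms(2-)
  proof (induction arbitrary: f rule: flag.induct)
    case flag_zero
    then show ?case using lin_map_zero[OF assms(1)] by auto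
  next
    case (flag_step U L v c)
    from flag_step.prems obtain u a where u: "f = (\<lambda>x. u x + a * v x)" "u \<in> U" by auto
    have c: "1 + c \<noteq> 0" using flag_step.prems(1)[of c] by (auto simp: add_eq_0_iff)
    \<comment> \<open>The coefficient that a solution must have along \<open>v\<close>, since
      \<open>v + T v\<close> is \<open>(1 + c) v\<close> modulo \<open>U\<close>.\<close>
    define b where "b = a / (1 + c)"
    have b: "b * (1 + c) = a" using c by (simp add: b_def)
    have "(\<lambda>x. u x - b * (T v x - c * v x)) \<in> U"
      using subsp_diff[OF flag_subsp[OF flag_step.hyps(1)] u(2) flag_step.hyps(3)] .
    then obtain s where s: "s \<in> U" "(\<lambda>x. s x + T s x) = (\<lambda>x. u x - b * (T v x - c * v x))"
      using flag_step.IH flag_step.prems(1) by (metis union_iff add_mset_add_single)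
    have "(\<lambda>x. (s x + b * v x) + T (\<lambda>x. s x + b * v x) x) = f"
    proof
      fix x
      have "s x + T s x = u x - b * (T v x - c * v x)" using s(2) by meson
      then show "(s x + b * v x) + T (\<lambda>x. s x + b * v x) x = f x"
        unfolding lin_mapD[OF assms(1)] u(1) b[symmetric] by (simp add: algebra_simps)
    qed
    moreover have "(\<lambda>x. s x + b * v x) \<in> {(\<lambda>x. u x + a * v x) | u a. u \<in> U}"
      using s(1) by blast
    ultimately show ?case by (rule bexI)
  qed
  then show ?thesis using that by blast
qed

text \<open>All intermediate spaces of a flag lie in \<open>U\<close>, so agreement on
  \<open>U\<close> suffices. It lets the zero map stand for \<open>top_op\<close> on a joint
  kernel.\<close>

lemma flag_cong:
  assumes "flag T U L" "\<And>f. f \<in> U \<Longrightarrow> T f = T' f"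
  shows "flag T' U L"
  using assms
proof (induction rule: flag.induct)
  case flag_zero
  show ?case by (rule flag.intros)
next
  case (flag_step U L v c)
  have 1: "u \<in> {(\<lambda>x. u x + a * v x) | u a. u \<in> U}" if "u \<in> U" for u
    using that by (auto intro!: exI[of _ u] exI[of _ 0])
  have "v \<in> {(\<lambda>x. u x + a * v x) | u a. u \<in> U}"
    using subsp_zero[OF flag_subsp[OF flag_step.hyps(1)]]
    by (auto intro!: exI[of _ "\<lambda>_. 0"] exI[of _ 1])
  then have "T v = T' v" using flag_step.prems by blast
  moreover have "flag T' U L" using flag_step.prems 1 by (intro flag_step.IH) blast
  ultimately show ?case using flag_step.hyps by (intro flag.intros) auto
qed

text \<open>A flag for the zero map is just a basis built up one vector at a time, so
  \<open>N\<close> is the dimension of \<open>V\<close>. Vanishing at one coordinate of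
  \<open>S\<close> lowers the dimension by at most one.\<close>

lemma flag_zero_map:
  assumes "finite S" "subsp V" "\<And>f x. f \<in> V \<Longrightarrow> x \<notin> S \<Longrightarrow> f x = 0"
  shows "\<exists>N. flag (\<lambda>_ _. 0) V (replicate_mset N 0)"
  using assms
proof (induction S arbitrary: V rule: finite_induct)
  case empty
  then have "V = {\<lambda>_. 0}" using subsp_zero by fastforce
  then show ?case using flag_zero[of "\<lambda>_ _. 0"] by (intro exI[of _ 0]) simp
next
  case (insert s S)
  define U where "U = {f \<in> V. f s = 0}"
  have "subsp U" using insert.prems(1) by (auto simp: U_def subsp_def)
  moreover have "f x = 0" if "f \<in> U" "x \<notin> S" for f x
    using that insert.prems(2) by (cases "x = s") (auto simp: U_def)
  ultimately obtain N where N: "flag (\<lambda>_ _. 0) U (replicate_mset N 0)" using insert.IH by blast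
  show ?case
  proof (cases "U = V")
    case True
    with N show ?thesis by blast
  next
    case False
    then obtain v where v: "v \<in> V" "v s \<noteq> 0" by (auto simp: U_def)
    have "{(\<lambda>x. u x + a * v x) | u a. u \<in> U} = V"
    proof (intro equalityI subsetI)
      fix f assume f: "f \<in> V"
      have "(\<lambda>x. f x - f s / v s * v x) \<in> U"
        using subsp_diff[OF insert.prems(1) f v(1), of "f s / v s"] v(2) by (simp add: U_def)
      then show "f \<in> {(\<lambda>x. u x + a * v x) | u a. u \<in> U}"
        by (force intro!: exI[of _ "\<lambda>x. f x - f s / v s * v x"] exI[of _ "f s / v s"])
    next
      fix f assume "f \<in> {(\<lambda>x. u x + a * v x) | u a. u \<in> U}"
      then show "f \<in> V" using subspD[OF insert.prems(1)] v by (auto simp: U_def)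
    qed
    moreover have "v \<notin> U" using v by (simp add: U_def)
    ultimately have "flag (\<lambda>_ _. 0) V (add_mset 0 (replicate_mset N 0))"
      using flag_step[OF N, of v 0] subsp_zero[OF \<open>subsp U\<close>] by simp
    then show ?thesis by (intro exI[of _ "Suc N"]) simp
  qed
qed

section \<open>From flags to triangular matrices and characteristic polynomials\<close>

lemma lin_map_sum:
  assumes "lin_map T"
  shows "T (\<lambda>x. \<Sum>i<n. c i * f i x) = (\<lambda>x. \<Sum>i<(n::nat). c i * T (f i) x)"
proof (induction n)
  case (Suc n)
  then show ?case using lin_mapD[OF assms, of "\<lambda>x. \<Sum>i<n. c i * f i x" "c n" "f n"] by simp
qed (simp add: lin_map_zero[OF assms])

text \<open>Images are stored in the rows of \<open>B\<close>, so that \<open>T (v i)\<close>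
  involves only \<open>v 0, ..., v i\<close>, matching the order in which a flag is built.\<close>

definition triangular_basis ::
  "(('a \<Rightarrow> real) \<Rightarrow> 'a \<Rightarrow> real) \<Rightarrow> ('a \<Rightarrow> real) set \<Rightarrow> nat \<Rightarrow>
    (nat \<Rightarrow> 'a \<Rightarrow> real) \<Rightarrow> (nat \<Rightarrow> nat \<Rightarrow> real) \<Rightarrow> bool" where
  "triangular_basis T V n v B \<longleftrightarrow>
    (\<forall>f\<in>V. \<exists>c. f = (\<lambda>x. \<Sum>i<n. c i * v i x)) \<and> (\<forall>i<n. v i \<in> V) \<and>
    (\<forall>c. (\<forall>x. (\<Sum>i<n. c i * v i x) = 0) \<longrightarrow> (\<forall>i<n. c i = 0)) \<and>
    (\<forall>i<n. T (v i) = (\<lambda>x. \<Sum>j<n. B i j * v j x)) \<and> (\<forall>j<n. \<forall>i<j. B i j = 0)"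

lemma triangular_basisD:
  assumes "triangular_basis T V n v B"
  shows "f \<in> V \<Longrightarrow> \<exists>c. f = (\<lambda>x. \<Sum>i<n. c i * v i x)"
    and "i < n \<Longrightarrow> v i \<in> V"
    and "(\<And>x. (\<Sum>i<n. c i * v i x) = 0) \<Longrightarrow> i < n \<Longrightarrow> c i = 0"
    and "i < n \<Longrightarrow> T (v i) = (\<lambda>x. \<Sum>j<n. B i j * v j x)"
    and "j < n \<Longrightarrow> i < j \<Longrightarrow> B i j = 0"
  using assms unfolding triangular_basis_def by simp_all

text \<open>The vectors adjoined by the flag steps form the basis: the step condition expresses
  \<open>T w - c w\<close> through the earlier ones.\<close>

lemma flag_triangular_basis:
  assumes "flag T V L"
  shows "\<exists>v B. triangular_basis T V (size L) v B \<and> L = image_mset (\<lambda>i. B i i) (mset_set {..<size L})"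
  using assms
proof (induction rule: flag.induct)
  case flag_zero
  show ?case by (auto simp: triangular_basis_def)
next
  case (flag_step U L w c)
  from flag_step.IH obtain v B where tb: "triangular_basis T U (size L) v B" and
    L: "L = image_mset (\<lambda>i. B i i) (mset_set {..<size L})" by blast
  note span = triangular_basisD(1)[OF tb] and U = triangular_basisD(2)[OF tb] and
    ind = triangular_basisD(3)[OF tb] and B = triangular_basisD(4,5)[OF tb]
  let ?N = "size L"
  note sU = flag_subsp[OF flag_step.hyps(1)]
  obtain b where b: "(\<lambda>x. T w x - c * w x) = (\<lambda>x. \<Sum>i<?N. b i * v i x)"
    using span[OF flag_step.hyps(3)] by blast
  define v' where "v' = v(?N := w)"
  define B' where "B' i j = (if i < ?N then if j < ?N then B i j else 0
    else if j < ?N then b j else c)" for i j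
  have sumU: "(\<lambda>x. \<Sum>i<k. d i * v i x) \<in> U" if "k \<le> ?N" for d k
    using that
  proof (induction k)
    case (Suc k)
    then show ?case using subspD[OF sU Suc.IH U[of k], of "d k"] by simp
  qed (simp add: subsp_zero[OF sU])
  let ?V = "{(\<lambda>x. u x + a * w x) | u a. u \<in> U}"
  have s: "(\<Sum>i<Suc ?N. d i * v' i x) = (\<Sum>i<?N. d i * v i x) + d ?N * w x" for d x
    by (simp add: v'_def)
  have "\<exists>c. f = (\<lambda>x. \<Sum>i<Suc ?N. c i * v' i x)" if "f \<in> ?V" for f
  proof -
    from that obtain u a where u: "f = (\<lambda>x. u x + a * w x)" "u \<in> U" by auto
    obtain d where "u = (\<lambda>x. \<Sum>i<?N. d i * v i x)" using span[OF u(2)] by blast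
    then have "f = (\<lambda>x. \<Sum>i<Suc ?N. (d(?N := a)) i * v' i x)" unfolding s by (simp add: u)
    then show ?thesis by blast
  qed
  moreover have "v' i \<in> ?V" if "i < Suc ?N" for i
  proof (cases "i = ?N")
    case True
    then show ?thesis using subsp_zero[OF sU]
      by (auto simp: v'_def intro!: exI[of _ "\<lambda>_. 0"] exI[of _ 1])
  next
    case False
    then show ?thesis using U[of i] that
      by (auto simp: v'_def intro!: exI[of _ "v i"] exI[of _ 0])
  qed
  moreover have "d i = 0" if d: "\<And>x. (\<Sum>i<Suc ?N. d i * v' i x) = 0" and i: "i < Suc ?N" for d i
  proof -
    have d0: "d ?N = 0"
    proof (rule ccontr)
      assume "d ?N \<noteq> 0"
      then have "w = (\<lambda>x. (- 1 / d ?N) * (\<Sum>i<?N. d i * v i x))"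
        using d unfolding s by (auto simp: fun_eq_iff field_simps add_eq_0_iff)
      moreover have "(\<lambda>x. (- 1 / d ?N) * (\<Sum>i<?N. d i * v i x)) \<in> U"
        by (rule subsp_scale[OF sU sumU]) simp
      ultimately show False using flag_step.hyps(2) by metis
    qed
    then have "(\<Sum>i<?N. d i * v i x) = 0" for x using d[of x] unfolding s by simp
    then show ?thesis using d0 ind[of d i] i by (cases "i = ?N") auto
  qed
  moreover have "T (v' i) = (\<lambda>x. \<Sum>j<Suc ?N. B' i j * v' j x)" if "i < Suc ?N" for i
  proof (cases "i = ?N")
    case True
    have "T w x = (\<Sum>i<?N. b i * v i x) + c * w x" for x using fun_cong[OF b, of x] by simp
    then show ?thesis unfolding s by (auto simp: True v'_def B'_def)
  next
    case False
    then show ?thesis unfolding s using B(1)[of i] that by (auto simp: v'_def B'_def)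
  qed
  moreover have "B' i j = 0" if "j < Suc ?N" "i < j" for i j
    using that B(2)[of j i] by (auto simp: B'_def)
  ultimately have "triangular_basis T ?V (Suc ?N) v' B'"
    unfolding triangular_basis_def by (intro conjI ballI allI impI) simp_all
  moreover have "add_mset c L = image_mset (\<lambda>i. B' i i) (mset_set {..<Suc ?N})"
  proof -
    have "image_mset (\<lambda>i. B' i i) (mset_set {..<?N}) = image_mset (\<lambda>i. B i i) (mset_set {..<?N})"
      by (rule image_mset_cong) (simp add: B'_def)
    then show ?thesis by (simp add: lessThan_Suc L[symmetric] B'_def)
  qed
  ultimately show ?case unfolding size_add_mset by blast
qed

text \<open>The unit vectors and the triangular basis span the same space, so the matrix of
  \<open>T\<close> is similar to a triangular one with diagonal \<open>L\<close>. The second claim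
  later turns flag lengths into dimension counts.\<close>

lemma flag_char_poly:
  fixes ws :: "'w list"
  assumes T: "lin_map T" and "flag T {f. \<forall>x. x \<notin> set ws \<longrightarrow> f x = 0} L" and "distinct ws"
  shows "char_poly (mat (length ws) (length ws) (\<lambda>(r, c). T (basis_vec (ws ! r)) (ws ! c))) =
    (\<Prod>c\<in>#L. [:- c, 1:])"
    and "size L = length ws"
proof -
  let ?V = "{f. \<forall>x. x \<notin> set ws \<longrightarrow> f x = 0}" and ?n = "length ws"
  define N where "N = size L"
  define e :: "nat \<Rightarrow> 'w \<Rightarrow> real" where "e r = basis_vec (ws ! r)" for r
  obtain v B where tb: "triangular_basis T ?V N v B" and
    L: "L = image_mset (\<lambda>i. B i i) (mset_set {..<N})"
    using flag_triangular_basis[OF assms(2)] unfolding N_def by blast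
  note span = triangular_basisD(1)[OF tb] and V = triangular_basisD(2)[OF tb] and
    ind = triangular_basisD(3)[OF tb] and B = triangular_basisD(4,5)[OF tb]
  have "\<exists>c. e r = (\<lambda>x. \<Sum>i<N. c i * v i x)" if "r < ?n" for r
    using that by (intro span) (auto simp: e_def basis_vec_def)
  then obtain Q where Q: "\<And>r. r < ?n \<Longrightarrow> e r = (\<lambda>x. \<Sum>i<N. Q r i * v i x)" by metis
  have e: "e r (ws ! c) = (if r = c then 1 else 0)" if "r < ?n" "c < ?n" for r c
    using that assms(3) by (auto simp: e_def basis_vec_def nth_eq_iff_index_eq)
  have expand: "f = (\<lambda>x. \<Sum>r<?n. f (ws ! r) * e r x)" if "f \<in> ?V" for f
  proof
    fix x
    show "f x = (\<Sum>r<?n. f (ws ! r) * e r x)"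
    proof (cases "x \<in> set ws")
      case True
      then obtain c where c: "c < ?n" "x = ws ! c" by (metis in_set_conv_nth)
      have "(\<Sum>r<?n. f (ws ! r) * e r x) = (\<Sum>r<?n. if r = c then f x else 0)"
        by (rule sum.cong) (auto simp: c e)
      then show ?thesis using c by simp
    next
      case False
      then have "e r x = 0" if "r < ?n" for r using that by (auto simp: e_def basis_vec_def)
      then show ?thesis using that False by simp
    qed
  qed
  have QP: "(\<Sum>i<N. Q r i * v i (ws ! c)) = (if r = c then 1 else 0)" if "r < ?n" "c < ?n" for r c
    using fun_cong[OF Q[OF that(1)], of "ws ! c"] e[OF that] by simp
  have PQ: "(\<Sum>r<?n. v i (ws ! r) * Q r k) = (if i = k then 1 else 0)" if "i < N" "k < N" for i k
  proof -
    \<comment> \<open>Expand \<open>v i\<close> in unit vectors and these again in the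
      \<open>v k\<close>; independence then compares the coefficients.\<close>
    have "(\<Sum>k<N. ((\<Sum>r<?n. v i (ws ! r) * Q r k) - (if i = k then 1 else 0)) * v k x) = 0" for x
    proof -
      have "(\<Sum>k<N. (\<Sum>r<?n. v i (ws ! r) * Q r k) * v k x) =
          (\<Sum>k<N. \<Sum>r<?n. v i (ws ! r) * (Q r k * v k x))"
        by (simp add: sum_distrib_right mult.assoc)
      also have "\<dots> = (\<Sum>r<?n. v i (ws ! r) * (\<Sum>k<N. Q r k * v k x))"
        by (subst sum.swap) (simp add: sum_distrib_left)
      also have "\<dots> = (\<Sum>r<?n. v i (ws ! r) * e r x)"
        by (intro sum.cong) (auto simp: Q)
      also have "\<dots> = v i x" using fun_cong[OF expand[OF V[OF that(1)]], of x] by simp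
      finally show ?thesis using that(1)
        by (simp add: left_diff_distrib sum_subtractf if_distrib[of "\<lambda>a. a * _"] cong: if_cong)
    qed
    from ind[OF this that(2)] show ?thesis by simp
  qed
  \<comment> \<open>The basis has as many elements as there are coordinates: compare the traces of \<open>QP\<close> and \<open>PQ\<close>.\<close>
  have "real ?n = (\<Sum>r<?n. \<Sum>i<N. Q r i * v i (ws ! r))" by (simp add: QP)
  also have "\<dots> = (\<Sum>i<N. \<Sum>r<?n. v i (ws ! r) * Q r i)"
    by (subst sum.swap) (simp add: mult.commute)
  also have "\<dots> = real N" by (simp add: PQ)
  finally have N: "N = ?n" by simp
  then show "size L = length ws" by (simp add: N_def)
  define MA where "MA = mat ?n ?n (\<lambda>(r, c). T (e r) (ws ! c))"
  define MP where "MP = mat ?n ?n (\<lambda>(i, r). v i (ws ! r))"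
  define MQ where "MQ = mat ?n ?n (\<lambda>(r, i). Q r i)"
  define MB where "MB = mat ?n ?n (\<lambda>(i, j). B i j)"
  have car: "MA \<in> carrier_mat ?n ?n" "MP \<in> carrier_mat ?n ?n" "MQ \<in> carrier_mat ?n ?n"
    "MB \<in> carrier_mat ?n ?n" by (simp_all add: MA_def MP_def MQ_def MB_def)
  have 1: "MQ * MP = 1\<^sub>m ?n"
    using QP by (intro eq_matI) (auto simp: MQ_def MP_def scalar_prod_def N atLeast0LessThan)
  have 2: "MP * MQ = 1\<^sub>m ?n"
    using PQ by (intro eq_matI) (auto simp: MQ_def MP_def scalar_prod_def N atLeast0LessThan)
  have 3: "MP * MA = MB * MP"
  proof (rule eq_matI)
    fix i c assume "i < dim_row (MB * MP)" "c < dim_col (MB * MP)"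
    then have ic: "i < ?n" "c < ?n" by (simp_all add: MB_def MP_def)
    have Tv: "T (v i) = (\<lambda>x. \<Sum>r<?n. v i (ws ! r) * T (e r) x)"
      using expand[OF V[of i]] lin_map_sum[OF T, where c = "\<lambda>r. v i (ws ! r)" and f = e and n = ?n] ic N
      by simp
    have "(\<Sum>r<?n. v i (ws ! r) * T (e r) (ws ! c)) = (\<Sum>j<?n. B i j * v j (ws ! c))"
      using fun_cong[OF Tv, of "ws ! c"] fun_cong[OF B(1)[of i], of "ws ! c"] ic N by simp
    then show "(MP * MA) $$ (i, c) = (MB * MP) $$ (i, c)"
      using ic by (simp add: MA_def MB_def MP_def scalar_prod_def atLeast0LessThan)
  qed (simp_all add: MA_def MB_def MP_def)
  have "MA = (MQ * MP) * MA" using car 1 by simp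
  also have "\<dots> = MQ * MB * MP" using car 3 by (simp add: assoc_mult_mat[of _ ?n ?n _ ?n _ ?n])
  finally have "similar_mat MA MB"
    using car 1 2 by (intro similar_matI[of _ _ MQ MP ?n]) auto
  \<comment> \<open>\<open>MB\<close> is lower triangular, whereas the rule for the diagonal is
    about upper triangular matrices.\<close>
  then have "char_poly MA = char_poly (transpose_mat MB)"
    using car by (simp add: char_poly_similar char_poly_transpose_mat[of _ ?n])
  also have "\<dots> = (\<Prod>a\<leftarrow>diag_mat (transpose_mat MB). [:- a, 1:])"
    using B(2) N car by (intro char_poly_upper_triangular[of _ ?n]) (auto simp: upper_triangular_def MB_def)
  also have "diag_mat (transpose_mat MB) = map (\<lambda>i. B i i) [0..<?n]"
    by (auto simp: diag_mat_def MB_def)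
  also have "(\<Prod>a\<leftarrow>map (\<lambda>i. B i i) [0..<?n]. [:- a, 1:]) = (\<Prod>i<?n. [:- B i i, 1:])"
    by (simp add: o_def prod.distinct_set_conv_list[symmetric] atLeast0LessThan)
  also have "\<dots> = (\<Prod>c\<in>#L. [:- c, 1:])"
    by (subst L) (simp add: prod_unfold_prod_mset N o_def multiset.map_comp)
  finally show "char_poly (mat ?n ?n (\<lambda>(r, c). T (basis_vec (ws ! r)) (ws ! c))) =
    (\<Prod>c\<in>#L. [:- c, 1:])" by (simp add: MA_def e_def)
qed

section \<open>The operators $d_k$\<close>

text \<open>
  The sum over \<open>i\<close> of the coefficients of \<open>v \<cdot> T\<^bsub>i-1\<^esub>\<dots>T\<^sub>1\<close> at \<open>k # u\<close> (see \<open>sum_hecke_coord\<close>): applying \<open>T\<^sub>1\<close>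
  last reduces it to the words behind the first letter.
\<close>

primrec del :: "real \<Rightarrow> nat list \<Rightarrow> nat \<Rightarrow> (nat list \<Rightarrow> real) \<Rightarrow> real" where
  "del q [] k v = v [k]"
| "del q (b # u) k v = v (k # b # u)
     + (if k < b then (q - 1) * del q u b (\<lambda>w. v (k # w)) else 0)
     + (if k \<le> b then q else 1) * del q u k (\<lambda>w. v (b # w))"

definition deriv :: "real \<Rightarrow> nat \<Rightarrow> (nat list \<Rightarrow> real) \<Rightarrow> nat list \<Rightarrow> real" where
  "deriv q k v = (\<lambda>u. del q u k v)"

definition insert_op :: "nat \<Rightarrow> (nat list \<Rightarrow> real) \<Rightarrow> nat list \<Rightarrow> real" where
  "insert_op k v u = (case u of [] \<Rightarrow> 0 | b # w \<Rightarrow> if b = k then v w else 0)"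

definition top_op :: "real \<Rightarrow> (nat \<Rightarrow> real) \<Rightarrow> (nat list \<Rightarrow> real) \<Rightarrow> nat list \<Rightarrow> real" where
  "top_op q y v u = (case u of [] \<Rightarrow> 0 | b # w \<Rightarrow> y b * del q w b v)"

lemma insert_op_simps [simp]:
  "insert_op k v [] = 0" "insert_op k v (b # w) = (if b = k then v w else 0)"
  by (simp_all add: insert_op_def)

lemma top_op_simps [simp]:
  "top_op q y v [] = 0" "top_op q y v (b # w) = y b * del q w b v"
  by (simp_all add: top_op_def)

lemma del_lin: "del q u k (\<lambda>w. f w + c * g w) = del q u k f + c * del q u k g"
  by (induction u arbitrary: k f g) (auto simp: algebra_simps)

lemma del_zero [simp]: "del q u k (\<lambda>w. 0) = 0"
  using del_lin[of q u k "\<lambda>_. 0" "-1" "\<lambda>_. 0"] by simp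

lemma del_add: "del q u k (\<lambda>w. f w + g w) = del q u k f + del q u k g"
  using del_lin[of q u k f 1 g] by simp

lemma del_scale: "del q u k (\<lambda>w. c * g w) = c * del q u k g"
  using del_lin[of q u k "\<lambda>_. 0" c g] by simp

lemma lin_map_deriv: "lin_map (deriv q k)"
  by (simp add: lin_map_def deriv_def del_lin)

lemma lin_map_top_op: "lin_map (top_op q y)"
  by (auto simp: lin_map_def top_op_def del_lin fun_eq_iff algebra_simps split: list.split)

text \<open>Only rearrangements of \<open>k # u\<close> are ever evaluated. This gives the support
  condition in \<open>deriv_support\<close>.\<close>

lemma del_cong:
  assumes "\<And>w. mset w = add_mset k (mset u) \<Longrightarrow> f w = g w"
  shows "del q u k f = del q u k g"
  using assms
proof (induction u arbitrary: k f g)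
  case (Cons b u)
  have "del q u b (\<lambda>w. f (k # w)) = del q u b (\<lambda>w. g (k # w))"
    by (rule Cons.IH) (auto intro: Cons.prems)
  moreover have "del q u k (\<lambda>w. f (b # w)) = del q u k (\<lambda>w. g (b # w))"
    by (rule Cons.IH) (auto intro: Cons.prems)
  ultimately show ?case using Cons.prems by simp
qed simp

text \<open>Induction on \<open>u\<close>: unfolding the first letter \<open>c\<close> on both sides
  leaves iterated \<open>del\<close> at the tail, for pairs among \<open>c\<close>,
  \<open>j\<close>, \<open>k\<close>. In each relative position of \<open>c\<close> the induction
  hypothesis brings them into a common order.\<close>

lemma del_commute:
  assumes "j < k"
  shows "del q u k (\<lambda>w. del q w j v) = q * del q u j (\<lambda>w. del q w k v)"
  using assms
proof (induction u arbitrary: j k v)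
  case Nil
  then show ?case by (simp add: algebra_simps)
next
  case (Cons c u)
  have X: "del q u b (\<lambda>w. del q w a (\<lambda>w. v (d # w))) = q * del q u a (\<lambda>w. del q w b (\<lambda>w. v (d # w)))"
    if "a < b" for a b d using Cons.IH[OF that] .
  consider "c < j" | "c = j" | "j < c" "c < k" | "c = k" | "k < c" by linarith
  then show ?case
  proof cases
    case 1
    then show ?thesis using Cons.prems X[of c j k] X[of c k j] X[of j k c]
      by (simp add: del_add del_scale) (simp add: algebra_simps)
  next
    case 2
    then show ?thesis using Cons.prems X[of j k j]
      by (simp add: del_add del_scale) (simp add: algebra_simps)
  next
    case 3
    then show ?thesis using Cons.prems X[of j c k] X[of c k j] X[of j k c]
      by (simp add: del_add del_scale) (simp add: algebra_simps)
  next
    case 4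
    then show ?thesis using Cons.prems X[of j k k]
      by (simp add: del_add del_scale) (simp add: algebra_simps)
  next
    case 5
    then show ?thesis using Cons.prems X[of j c k] X[of k c j] X[of j k c]
      by (simp add: del_add del_scale) (simp add: algebra_simps)
  qed
qed

lemma deriv_commute: "j < k \<Longrightarrow> deriv q k (deriv q j v) = (\<lambda>u. q * deriv q j (deriv q k v) u)"
  by (simp add: deriv_def del_commute)

text \<open>At \<open>b # w\<close> the recursion for \<open>del\<close> produces \<open>d_k\<close>
  and \<open>d_b\<close> in both orders, which \<open>del_commute\<close> reconciles. The term with
  \<open>q - 1\<close>, present only for \<open>k < b\<close>, is what mixes \<open>y k\<close> into
  the weights of the larger letters.\<close>

lemma deriv_top_op:
  "deriv q k (top_op q y v) =
    (\<lambda>u. y k * deriv q k v u +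
      top_op q (\<lambda>i. if k < i then y i + (q - 1) * y k else q * y i) (deriv q k v) u)"
proof
  fix u
  show "deriv q k (top_op q y v) u = y k * deriv q k v u +
      top_op q (\<lambda>i. if k < i then y i + (q - 1) * y k else q * y i) (deriv q k v) u"
  proof (cases u)
    case (Cons b w)
    show ?thesis
      using del_commute[of k b q w v] del_commute[of b k q w v]
      by (cases k b rule: linorder_cases) (simp_all add: Cons deriv_def del_scale algebra_simps)
  qed (simp add: deriv_def)
qed

text \<open>Up to a scalar \<open>d_j\<close> passes through the prepended letter, so prepending
  \<open>k\<close> keeps a vector in the kernel of \<open>d_j\<close>.\<close>

lemma deriv_insert_op:
  assumes "j \<noteq> k"
  shows "deriv q j (insert_op k v) = (\<lambda>u. (if j \<le> k then q else 1) * insert_op k (deriv q j v) u)"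
proof
  fix u
  show "deriv q j (insert_op k v) u = (if j \<le> k then q else 1) * insert_op k (deriv q j v) u"
    using assms by (cases u) (auto simp: deriv_def)
qed

text \<open>The correction to the identity is again a \<open>top_op\<close>, with weights that are
  nonnegative for \<open>q \<ge> 1\<close>; hence \<open>-1\<close> will not be an eigenvalue of
  it.\<close>

lemma deriv_insert_op_same:
  "deriv q k (insert_op k v) =
    (\<lambda>u. v u + top_op q (\<lambda>b. if k < b then q - 1 else if b = k then q else 0) v u)"
proof
  fix u
  show "deriv q k (insert_op k v) u =
    v u + top_op q (\<lambda>b. if k < b then q - 1 else if b = k then q else 0) v u"
    by (cases u) (auto simp: deriv_def)
qed

section \<open>Joint kernels and the eigenvalues\<close>

text \<open>Indexes the eigenvalues on the joint kernel for \<open>J\<close>: there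
  \<open>d_j\<close> vanishes for \<open>j \<in> J\<close>, so such letters cannot be removed from a
  word and do not occur in \<open>A\<close>.\<close>

definition submsets :: "nat set \<Rightarrow> nat multiset \<Rightarrow> nat multiset set" where
  "submsets J M = {A. A \<subseteq># M \<and> set_mset A \<inter> J = {}}"

lemma finite_submsets: "finite (submsets J M)"
proof (rule finite_subset)
  show "submsets J M \<subseteq> mset ` {xs. set xs \<subseteq> set_mset M \<and> length xs \<le> size M}"
  proof
    fix A assume "A \<in> submsets J M"
    then have "A \<subseteq># M" by (simp add: submsets_def)
    moreover obtain xs where "mset xs = A" using ex_mset by blast
    ultimately show "A \<in> mset ` {xs. set xs \<subseteq> set_mset M \<and> length xs \<le> size M}"
      using set_mset_mono size_mset_mono by (fastforce intro!: image_eqI[of _ _ xs])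
  qed
qed (simp add: finite_lists_length_le)

lemma submsets_trivial: "set_mset M \<subseteq> J \<Longrightarrow> submsets J M = {{#}}"
proof (intro equalityI subsetI)
  fix A assume "set_mset M \<subseteq> J" "A \<in> submsets J M"
  then have "set_mset A = {}" using set_mset_mono[of A M] by (auto simp: submsets_def)
  then show "A \<in> {{#}}" by simp
qed (simp add: submsets_def)

text \<open>Either \<open>A\<close> avoids \<open>k\<close>, or one copy of \<open>k\<close> is
  taken out of it. The two sums will belong to the kernel and the image of
  \<open>d_k\<close>.\<close>

lemma sum_submsets_split:
  fixes f :: "nat multiset \<Rightarrow> 'b :: comm_monoid_add"
  assumes "k \<in># M" "k \<notin> J"
  shows "(\<Sum>A\<in>submsets J M. f A) =
    (\<Sum>A\<in>submsets (insert k J) M. f A) + (\<Sum>A\<in>submsets J (M - {#k#}). f (add_mset k A))"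
proof -
  have "submsets J M = submsets (insert k J) M \<union> add_mset k ` submsets J (M - {#k#})"
  proof (intro equalityI subsetI)
    fix A assume A: "A \<in> submsets J M"
    show "A \<in> submsets (insert k J) M \<union> add_mset k ` submsets J (M - {#k#})"
    proof (cases "k \<in># A")
      case True
      then obtain B where "A = add_mset k B" by (metis insert_DiffM)
      with A show ?thesis
        using insert_subset_eq_iff[of k B M] by (auto simp: submsets_def)
    qed (use A in \<open>auto simp: submsets_def\<close>)
  next
    fix A assume "A \<in> submsets (insert k J) M \<union> add_mset k ` submsets J (M - {#k#})"
    then show "A \<in> submsets J M"
      using assms by (auto simp: submsets_def insert_subset_eq_iff)
  qed
  moreover have "submsets (insert k J) M \<inter> add_mset k ` submsets J (M - {#k#}) = {}"
    by (auto simp: submsets_def)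
  ultimately show ?thesis
    by (simp add: sum.union_disjoint finite_submsets sum.reindex inj_on_def)
qed

section \<open>The eigenvalues as functions of a submultiset and arbitrary weights\<close>

definition eig_mset :: "real \<Rightarrow> (nat \<Rightarrow> real) \<Rightarrow> nat multiset \<Rightarrow> real" where
  "eig_mset q y A = (\<Sum>j\<in>set_mset A. y j * (q ^ size (filter_mset ((<) j) A) * qint q (count A j)))"

lemma eig_mset_superset:
  assumes "finite S" "set_mset A \<subseteq> S"
  shows "eig_mset q y A = (\<Sum>j\<in>S. y j * (q ^ size (filter_mset ((<) j) A) * qint q (count A j)))"
  unfolding eig_mset_def using assms
  by (intro sum.mono_neutral_left) (auto simp: qint_def not_in_iff)

lemma eig_mset_nonneg: "q \<ge> 0 \<Longrightarrow> (\<And>j. y j \<ge> 0) \<Longrightarrow> eig_mset q y A \<ge> 0"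
  unfolding eig_mset_def qint_def by (intro sum_nonneg mult_nonneg_nonneg) auto

lemma eig_mset_empty [simp]: "eig_mset q y {#} = 0"
  by (simp add: eig_mset_def)

text \<open>A telescoping sum. The induction adds a smallest letter \<open>x\<close>, which leaves
  the terms of all other letters unchanged and raises its own by
  \<open>(q - 1) * q ^ size A\<close>.\<close>

lemma eig_mset_const: "eig_mset q (\<lambda>_. q - 1) A = q ^ size A - 1"
proof (induction A rule: multiset_induct_min)
  case (add x A)
  let ?S = "insert x (set_mset A)"
  define g where "g A j = (q - 1) * (q ^ size (filter_mset ((<) j) A) * qint q (count A j))" for A :: "nat multiset" and j
  have "eig_mset q (\<lambda>_. q - 1) (add_mset x A) = (\<Sum>j\<in>?S. g (add_mset x A) j)"
    by (simp add: eig_mset_def g_def)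
  also have "\<dots> = (\<Sum>j\<in>?S. g A j + (if j = x then (q - 1) * q ^ size A else 0))"
  proof (rule sum.cong)
    fix j assume j: "j \<in> ?S"
    have "A = filter_mset ((<) x) A + replicate_mset (count A x) x"
      using add.hyps by (intro multiset_eqI) (auto simp: not_in_iff order.strict_iff_order)
    then have "size A = size (filter_mset ((<) x) A) + count A x"
      by (metis size_union size_replicate_mset)
    then show "g (add_mset x A) j = g A j + (if j = x then (q - 1) * q ^ size A else 0)"
      using j add.hyps by (auto simp: g_def qint_def algebra_simps power_add)
  qed simp
  also have "\<dots> = eig_mset q (\<lambda>_. q - 1) A + (q - 1) * q ^ size A"
    by (simp add: eig_mset_superset[of ?S A, OF _ subset_insertI] sum.distrib g_def)
  finally show ?case using add.IH by (simp add: algebra_simps)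
qed simp

text \<open>The weights change exactly as in \<open>deriv_top_op\<close>. A new \<open>k\<close>
  multiplies the terms of smaller letters by \<open>q\<close> and leaves those of larger letters
  alone; the excess given to the latter sums to \<open>y k * (q ^ size ?B - 1)\<close> by
  \<open>eig_mset_const\<close> and is balanced by the new term at \<open>k\<close>.\<close>

lemma eig_mset_add_mset:
  "eig_mset q y (add_mset k A) = y k + eig_mset q (\<lambda>i. if k < i then y i + (q - 1) * y k else q * y i) A"
proof -
  let ?S = "insert k (set_mset A)" and ?B = "filter_mset ((<) k) A"
  define g where "g A j = q ^ size (filter_mset ((<) j) A) * qint q (count A j)" for A :: "nat multiset" and j
  have "qint q (Suc n) = 1 + q * qint q n" for n
    by (simp add: qint_def sum.lessThan_Suc_shift sum_distrib_left del: sum.lessThan_Suc)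
  then have g: "y j * g (add_mset k A) j =
      (if k < j then y j + (q - 1) * y k else q * y j) * g A j
      - (if k < j then y k * ((q - 1) * g A j) else 0) + (if j = k then y k * q ^ size ?B else 0)" for j
    by (auto simp: g_def algebra_simps)
  have "(\<Sum>j\<in>?S. if k < j then y k * ((q - 1) * g A j) else 0) =
      (\<Sum>j\<in>set_mset ?B. y k * ((q - 1) * g A j))"
    by (rule sum.mono_neutral_cong_right) auto
  also have "\<dots> = y k * eig_mset q (\<lambda>_. q - 1) ?B"
    unfolding eig_mset_def sum_distrib_left
  proof (rule sum.cong)
    fix j assume "j \<in> set_mset ?B"
    then have "filter_mset ((<) j) A = filter_mset ((<) j) ?B" "count A j = count ?B j"
      by (auto simp: filter_filter_mset intro!: filter_mset_cong)
    then show "y k * ((q - 1) * g A j) =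
        y k * ((q - 1) * (q ^ size (filter_mset ((<) j) ?B) * qint q (count ?B j)))"
      by (simp add: g_def)
  qed simp
  also have "\<dots> = y k * (q ^ size ?B - 1)" by (simp add: eig_mset_const)
  finally have 1: "(\<Sum>j\<in>?S. if k < j then y k * ((q - 1) * g A j) else 0) = y k * (q ^ size ?B - 1)" .
  have "eig_mset q y (add_mset k A) = (\<Sum>j\<in>?S. y j * g (add_mset k A) j)"
    by (simp add: eig_mset_def g_def)
  also have "\<dots> = eig_mset q (\<lambda>i. if k < i then y i + (q - 1) * y k else q * y i) A
      - y k * (q ^ size ?B - 1) + y k * q ^ size ?B"
    unfolding g using 1
    by (simp add: eig_mset_superset[of ?S A, OF _ subset_insertI] sum.distrib sum_subtractf)
      (simp add: g_def)
  finally show ?thesis by (simp add: algebra_simps)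
qed

section \<open>Joint kernels and the action of the operators on them\<close>

definition ker_space :: "real \<Rightarrow> nat set \<Rightarrow> nat multiset \<Rightarrow> (nat list \<Rightarrow> real) set" where
  "ker_space q J M = {v. (\<forall>u. mset u \<noteq> M \<longrightarrow> v u = 0) \<and> (\<forall>j\<in>J. deriv q j v = (\<lambda>_. 0))}"

lemma subsp_ker_space: "subsp (ker_space q J M)"
  using lin_map_zero[OF lin_map_deriv[of q]]
  by (auto simp: ker_space_def subsp_def lin_mapD[OF lin_map_deriv])

lemma deriv_support:
  assumes "v \<in> ker_space q J M" "add_mset k (mset u) \<noteq> M"
  shows "deriv q k v u = 0"
proof -
  have "del q u k v = del q u k (\<lambda>_. 0)"
    using assms by (intro del_cong) (auto simp: ker_space_def)
  then show ?thesis by (simp add: deriv_def)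
qed

lemma deriv_not_in: "v \<in> ker_space q J M \<Longrightarrow> k \<notin># M \<Longrightarrow> deriv q k v = (\<lambda>_. 0)"
  using deriv_support by fastforce

text \<open>\<open>d_j\<close> is moved past \<open>d_k\<close> by the commutation rule; for
  \<open>j < k\<close> this leaves a factor \<open>q\<close> to be cancelled, hence
  \<open>q \<noteq> 0\<close>.\<close>

lemma deriv_ker_space:
  assumes "v \<in> ker_space q J M" "k \<in># M" "q \<noteq> 0"
  shows "deriv q k v \<in> ker_space q J (M - {#k#})"
  unfolding ker_space_def
proof (intro CollectI conjI allI impI ballI)
  fix u assume "mset u \<noteq> M - {#k#}"
  then have "add_mset k (mset u) \<noteq> M" by auto
  then show "deriv q k v u = 0" using deriv_support assms(1) by blast
next
  fix j assume "j \<in> J"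
  then have j: "deriv q j v = (\<lambda>_. 0)" using assms(1) by (simp add: ker_space_def)
  have z: "deriv q k (\<lambda>_. 0) = (\<lambda>_. 0)" by (simp add: lin_map_zero[OF lin_map_deriv])
  show "deriv q j (deriv q k v) = (\<lambda>_. 0)"
  proof (cases j k rule: linorder_cases)
    case less
    then show ?thesis using fun_cong[OF deriv_commute[of j k q v]] j z assms(3) by (simp add: fun_eq_iff)
  next
    case equal
    then show ?thesis using j z by simp
  next
    case greater
    then show ?thesis using deriv_commute[of k j q v] j z by simp
  qed
qed

lemma top_op_ker_space:
  assumes "v \<in> ker_space q J M"
  shows "top_op q y v \<in> ker_space q J M"
  unfolding ker_space_def
proof (intro CollectI conjI allI impI ballI)
  fix u assume "mset u \<noteq> M"
  then show "top_op q y v u = 0"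
    using deriv_support[OF assms] by (cases u) (auto simp: deriv_def)
next
  fix j assume "j \<in> J"
  then have j: "deriv q j v = (\<lambda>_. 0)" using assms(1) by (simp add: ker_space_def)
  show "deriv q j (top_op q y v) = (\<lambda>_. 0)"
    by (simp add: deriv_top_op j lin_map_zero[OF lin_map_top_op])
qed

lemma insert_op_ker_space:
  assumes "v \<in> ker_space q J (M - {#k#})" "k \<in># M" "k \<notin> J"
  shows "insert_op k v \<in> ker_space q J M"
  unfolding ker_space_def
proof (intro CollectI conjI allI impI ballI)
  fix u assume "mset u \<noteq> M"
  then have "mset w \<noteq> M - {#k#}" if "u = k # w" for w using that assms(2) by auto
  then show "insert_op k v u = 0"
    using assms(1) by (cases u) (auto simp: ker_space_def)
next
  fix j assume "j \<in> J"
  then have "deriv q j v = (\<lambda>_. 0)" "j \<noteq> k" using assms by (auto simp: ker_space_def)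
  then show "deriv q j (insert_op k v) = (\<lambda>_. 0)"
    by (auto simp: deriv_insert_op insert_op_def fun_eq_iff split: list.split)
qed

lemma top_op_trivial:
  assumes "v \<in> ker_space q J M" "set_mset M \<subseteq> J"
  shows "top_op q y v = (\<lambda>_. 0)"
proof
  have "deriv q b v = (\<lambda>_. 0)" for b
    using assms deriv_not_in[OF assms(1), of b] by (cases "b \<in># M") (auto simp: ker_space_def)
  then have "del q w b v = 0" for w b by (metis deriv_def)
  then show "top_op q y v u = 0" for u by (cases u) auto
qed

lemma ker_space_trivial: "set_mset M \<subseteq> J \<Longrightarrow> ker_space q J M = ker_space q UNIV M"
proof (intro equalityI subsetI)
  fix v assume "set_mset M \<subseteq> J" "v \<in> ker_space q J M"
  then show "v \<in> ker_space q UNIV M"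
    using deriv_not_in[of v q J M] unfolding ker_space_def by blast
qed (auto simp: ker_space_def)

text \<open>The dimension of the joint kernel of all \<open>d_j\<close>, as the length of a flag for
  the zero map. \<open>UNIV\<close> serves every \<open>J\<close> containing the letters of
  \<open>M\<close>, since the other letters impose no condition.\<close>

definition ker_mult :: "real \<Rightarrow> nat multiset \<Rightarrow> nat" where
  "ker_mult q M = (SOME N. flag (\<lambda>_ _. 0) (ker_space q UNIV M) (replicate_mset N 0))"

lemma flag_ker_mult: "flag (\<lambda>_ _. 0) (ker_space q UNIV M) (replicate_mset (ker_mult q M) 0)"
  unfolding ker_mult_def
proof (rule someI_ex, rule flag_zero_map)
  have "finite {u. set u \<subseteq> set_mset M \<and> length u = size M}" by (simp add: finite_lists_length_eq)
  then show "finite {u. mset u = M}" by (rule finite_subset[rotated]) auto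
next
  show "subsp (ker_space q UNIV M)" by (rule subsp_ker_space)
qed (auto simp: ker_space_def)

text \<open>Outer induction on the size of \<open>M\<close>, inner induction on the number of
  letters of \<open>M\<close> outside \<open>J\<close>. For such a letter \<open>k\<close>,
  \<open>flag_extend\<close> joins the flag for \<open>insert k J\<close> to the one for
  \<open>M - {#k#}\<close>. The weights stay general because \<open>d_k\<close> changes
  them.\<close>

lemma flag_top_op:
  assumes "q \<ge> 1"
  shows "flag (top_op q y) (ker_space q J M)
    (\<Sum>A\<in>submsets J M. replicate_mset (ker_mult q (M - A)) (eig_mset q y A))"
proof (induction "size M" arbitrary: y J M rule: less_induct)
  case less
  note outer = less.hyps
  show ?case
  proof (induction "card (set_mset M - J)" arbitrary: y J rule: less_induct)
    case less
    show ?case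
    proof (cases "set_mset M \<subseteq> J")
      case True
      have "flag (top_op q y) (ker_space q UNIV M) (replicate_mset (ker_mult q M) 0)"
        by (rule flag_cong[OF flag_ker_mult]) (simp add: top_op_trivial)
      then show ?thesis by (simp add: submsets_trivial[OF True] ker_space_trivial[OF True])
    next
      case False
      then obtain k where k: "k \<in># M" "k \<notin> J" by auto
      let ?y = "\<lambda>i. if k < i then y i + (q - 1) * y k else q * y i"
        and ?z = "\<lambda>b. if k < b then q - 1 else if b = k then q else 0"
        and ?M = "M - {#k#}"
      have size: "size ?M < size M" using k(1) by (simp add: size_Diff1_less)
      have "card (set_mset M - insert k J) < card (set_mset M - J)"
        using k by (intro psubset_card_mono) auto
      from less.hyps[OF this] have
        U: "flag (top_op q y) (ker_space q (insert k J) M)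
          (\<Sum>A\<in>submsets (insert k J) M. replicate_mset (ker_mult q (M - A)) (eig_mset q y A))" .
      \<comment> \<open>The weights \<open>?z\<close> come from \<open>deriv_insert_op_same\<close>:
        this instance serves only to invert the identity plus \<open>top_op q ?z\<close>.\<close>
      note F = outer[OF size, of ?z J]
      have surj: "deriv q k ` ker_space q J M = ker_space q J ?M"
      proof (intro equalityI subsetI)
        fix f assume f: "f \<in> ker_space q J ?M"
        have nn: "c \<noteq> -1" if "c \<in># (\<Sum>A\<in>submsets J ?M. replicate_mset (ker_mult q (?M - A)) (eig_mset q ?z A))" for c
        proof -
          from that obtain A where "c = eig_mset q ?z A"
            by (auto simp: set_mset_sum finite_submsets split: if_splits)
          then have "c \<ge> 0" using assms by (auto intro!: eig_mset_nonneg)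
          then show ?thesis by simp
        qed
        obtain s where s: "s \<in> ker_space q J ?M" "(\<lambda>x. s x + top_op q ?z s x) = f"
          by (rule flag_solve[OF lin_map_top_op F nn f])
        have "f = deriv q k (insert_op k s)" using s(2) by (simp add: deriv_insert_op_same)
        then show "f \<in> deriv q k ` ker_space q J M" using insert_op_ker_space[OF s(1) k] by blast
      next
        fix f assume "f \<in> deriv q k ` ker_space q J M"
        then show "f \<in> ker_space q J ?M" using assms by (auto intro!: deriv_ker_space k(1))
      qed
      have ker: "{f \<in> ker_space q J M. deriv q k f = (\<lambda>_. 0)} = ker_space q (insert k J) M"
        by (auto simp: ker_space_def)
      \<comment> \<open>Shifting by \<open>y k\<close> turns the eigenvalues for \<open>A\<close>
        with the changed weights into those for \<open>add_mset k A\<close> with the original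
        ones.\<close>
      have "image_mset ((+) (y k)) (\<Sum>A\<in>submsets J ?M. replicate_mset (ker_mult q (?M - A)) (eig_mset q ?y A)) =
          (\<Sum>A\<in>submsets J ?M. replicate_mset (ker_mult q (M - add_mset k A)) (eig_mset q y (add_mset k A)))"
        using sum_comp_morphism[of "image_mset ((+) (y k))"
            "\<lambda>A. replicate_mset (ker_mult q (?M - A)) (eig_mset q ?y A)" "submsets J ?M"]
        by (simp add: eig_mset_add_mset o_def)
      then have "flag (\<lambda>f x. y k * f x + top_op q ?y f x) (ker_space q J ?M)
          (\<Sum>A\<in>submsets J ?M. replicate_mset (ker_mult q (M - add_mset k A)) (eig_mset q y (add_mset k A)))"
        using flag_shift[OF outer[OF size, of ?y J], of "y k"] by simp
      moreover have "lin_map (\<lambda>f x. y k * f x + top_op q ?y f x)"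
        using lin_map_top_op[of q ?y] by (simp add: lin_map_def algebra_simps fun_eq_iff)
      ultimately show ?thesis
        unfolding sum_submsets_split[OF k]
        by (intro flag_extend[OF lin_map_top_op _ lin_map_deriv _ _ subsp_ker_space surj])
          (simp_all only: ker U top_op_ker_space deriv_top_op)
    qed
  qed
qed

section \<open>The Tsetlin library on words\<close>

definition word_mset :: "nat \<Rightarrow> (nat \<Rightarrow> nat) \<Rightarrow> nat multiset" where
  "word_mset l m = (\<Sum>j=1..l. replicate_mset (m j) j)"

lemma count_word_mset: "count (word_mset l m) k = (if k \<in> {1..l} then m k else 0)"
  by (simp add: word_mset_def count_sum)

lemma size_word_mset: "size (word_mset l m) = (\<Sum>j=1..l. m j)"
  unfolding word_mset_def by (induction l) auto

lemma words_eq: "words l m = {w. mset w = word_mset l m}"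
proof (intro equalityI subsetI)
  fix w assume w: "w \<in> words l m"
  have "count (mset w) k = count (word_mset l m) k" for k
    using w by (auto simp: words_def count_word_mset count_mset count_list_0_iff)
  then show "w \<in> {w. mset w = word_mset l m}" by (simp add: multiset_eqI)
next
  fix w assume "w \<in> {w. mset w = word_mset l m}"
  then have w: "mset w = word_mset l m" by simp
  have "length w = (\<Sum>j=1..l. m j)" using arg_cong[OF w, of size] by (simp add: size_word_mset)
  moreover have "set w \<subseteq> {1..l}"
  proof
    fix k assume "k \<in> set w"
    then have "count (word_mset l m) k \<noteq> 0" by (simp add: w[symmetric] count_mset count_list_0_iff)
    then show "k \<in> {1..l}" by (simp add: count_word_mset split: if_splits)
  qed
  moreover have "count_list w k = m k" if "k \<in> {1..l}" for k
    using that by (simp add: count_mset[symmetric] w count_word_mset)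
  ultimately show "w \<in> words l m" by (simp add: words_def)
qed

lemma finite_mset_eq: "finite {w. mset w = M}"
proof (rule finite_subset)
  show "{w. mset w = M} \<subseteq> {w. set w \<subseteq> set_mset M \<and> length w = size M}" by auto
qed (simp add: finite_lists_length_eq)

section \<open>Hecke operators in coordinates\<close>

lemma mset_swap_at: "i < length w \<Longrightarrow> mset (swap_at i w) = mset w"
  unfolding swap_at_def by (rule mset_swap) auto

lemma swap_at_swap_at: "0 < i \<Longrightarrow> i < length w \<Longrightarrow> swap_at i (swap_at i w) = w"
  by (auto simp: swap_at_def nth_list_update intro!: nth_equalityI)

text \<open>The transposed action: the coefficient at \<open>u\<close> collects contributions from
  \<open>u\<close> and \<open>swap_at i u\<close>, and for the swapped word the comparison of
  letters is reversed. No word set enters, which permits passing to tails of words.\<close>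

definition hecke_coord :: "real \<Rightarrow> nat \<Rightarrow> (nat list \<Rightarrow> real) \<Rightarrow> nat list \<Rightarrow> real" where
  "hecke_coord q i v u = (if u ! (i - 1) \<le> u ! i then q else 1) * v (swap_at i u) +
    (if u ! (i - 1) < u ! i then q - 1 else 0) * v u"

lemma hecke_eq:
  assumes "mset u = M" "0 < i" "i < length u"
  shows "hecke {w. mset w = M} q i v u = hecke_coord q i v u"
proof -
  let ?W = "{w. mset w = M}"
  have "hecke ?W q i v u = (\<Sum>w\<in>?W.
      (if w = swap_at i u then v (swap_at i u) * (if u ! (i - 1) \<le> u ! i then q else 1) else 0) +
      (if w = u then v u * (if u ! (i - 1) < u ! i then q - 1 else 0) else 0))"
    unfolding hecke_def lin_ext_def
  proof (rule sum.cong)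
    fix w assume "w \<in> ?W"
    then have w: "i < length w" using assms by (metis mem_Collect_eq size_mset)
    have 1: "u = swap_at i w \<longleftrightarrow> w = swap_at i u"
      using swap_at_swap_at[of i] assms w by metis
    have 2: "w ! (i - 1) = u ! i" "w ! i = u ! (i - 1)" if "w = swap_at i u"
      using assms by (simp_all add: that swap_at_def nth_list_update)
    show "v w * (if w ! i \<le> w ! (i - 1) then \<lambda>u. q * basis_vec (swap_at i w) u
        else (\<lambda>u. basis_vec (swap_at i w) u + (q - 1) * basis_vec w u)) u =
      (if w = swap_at i u then v (swap_at i u) * (if u ! (i - 1) \<le> u ! i then q else 1) else 0) +
      (if w = u then v u * (if u ! (i - 1) < u ! i then q - 1 else 0) else 0)"
      using 2 swap_at_swap_at[of i u] assms by (auto simp: basis_vec_def 1 algebra_simps)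
  qed simp
  also have "\<dots> = hecke_coord q i v u"
    using assms by (simp add: sum.distrib finite_mset_eq mset_swap_at hecke_coord_def mult.commute)
  finally show ?thesis .
qed

text \<open>Generalised over two vectors, because the two kinds of operators agree only on content
  \<open>M\<close>.\<close>

lemma fold_hecke_eq:
  assumes "\<And>u. mset u = M \<Longrightarrow> v u = v' u" "i \<le> size M" "mset u = M"
  shows "fold (hecke {w. mset w = M} q) (rev [1..<i]) v u = fold (hecke_coord q) (rev [1..<i]) v' u"
  using assms
proof (induction i arbitrary: v v' u)
  case (Suc i)
  show ?case
  proof (cases "i = 0")
    case False
    have "hecke {w. mset w = M} q i v u = hecke_coord q i v' u" if "mset u = M" for u
    proof -
      have "i < length u" using Suc.prems(2) that by auto
      then show ?thesis using False that Suc.prems(1) mset_swap_at[of i u]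
        by (simp add: hecke_eq hecke_coord_def)
    qed
    then show ?thesis using False Suc by simp
  qed (use Suc.prems in simp)
qed simp

lemma hecke_coord_Cons:
  assumes "0 < i"
  shows "hecke_coord q (Suc i) v (b # w) = hecke_coord q i (\<lambda>w. v (b # w)) w"
proof -
  have "swap_at (Suc i) (b # w) = b # swap_at i w"
    using assms by (cases i) (simp_all add: swap_at_def)
  then show ?thesis using assms by (simp add: hecke_coord_def nth_Cons')
qed

lemma fold_hecke_coord_Cons:
  assumes "0 \<notin> set is"
  shows "fold (hecke_coord q) (map Suc is) v (b # w) = fold (hecke_coord q) is (\<lambda>w. v (b # w)) w"
  using assms by (induction "is" arbitrary: v) (simp_all add: hecke_coord_Cons)

lemma sum_hecke_coord:
  "(\<Sum>i=1..Suc (length u). fold (hecke_coord q) (rev [1..<i]) v (k # u)) = del q u k v"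
proof (induction u arbitrary: k v)
  case (Cons b u)
  let ?F = "\<lambda>i. fold (hecke_coord q) (rev [1..<i])"
  \<comment> \<open>\<open>T_1\<close> is applied last, so its coordinate formula is unfolded first;
    the operators before it do not touch the first letter and act on the tail with indices lowered
    by one.\<close>
  have F: "?F (Suc i) v (k # b # u) = (if k \<le> b then q else 1) * ?F i (\<lambda>w. v (b # w)) (k # u) +
      (if k < b then q - 1 else 0) * ?F i (\<lambda>w. v (k # w)) (b # u)" if "i \<ge> 1" for i
  proof -
    have "[1..<Suc i] = 1 # map Suc [1..<i]"
      using that by (simp add: upt_conv_Cons map_Suc_upt del: upt_Suc)
    then have "rev [1..<Suc i] = map Suc (rev [1..<i]) @ [1]" by (simp add: rev_map)
    then have "?F (Suc i) v (k # b # u) =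
        hecke_coord q 1 (fold (hecke_coord q) (map Suc (rev [1..<i])) v) (k # b # u)"
      by simp
    then show ?thesis by (simp add: hecke_coord_def swap_at_def fold_hecke_coord_Cons)
  qed
  have "(\<Sum>i=1..Suc (Suc (length u)). ?F i v (k # b # u)) =
      v (k # b # u) + (\<Sum>i=1..Suc (length u). ?F (Suc i) v (k # b # u))"
    by (subst sum.atLeast_Suc_atMost, simp, subst sum.shift_bounds_cl_Suc_ivl)
      (simp del: upt_Suc sum.cl_ivl_Suc)
  also have "\<dots> = del q (b # u) k v"
  proof -
    have "(\<Sum>i=1..Suc (length u). ?F (Suc i) v (k # b # u)) =
        (\<Sum>i=1..Suc (length u). (if k \<le> b then q else 1) * ?F i (\<lambda>w. v (b # w)) (k # u) +
          (if k < b then q - 1 else 0) * ?F i (\<lambda>w. v (k # w)) (b # u))"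
      by (rule sum.cong) (simp_all only: F atLeastAtMost_iff)
    then show ?thesis by (simp only: sum.distrib sum_distrib_left[symmetric] Cons.IH) simp
  qed
  finally show ?case by simp
qed simp

text \<open>The weight operator multiplies the coefficient at \<open>k # w\<close> by a constant
  depending on \<open>k\<close>, and \<open>sum_hecke_coord\<close> evaluates the remaining
  sum.\<close>

lemma tsetlin_eq:
  assumes "u \<in> words l m"
  shows "tsetlin l m q x v u =
    top_op q (\<lambda>j. x j / (q ^ (\<Sum>k=j+1..l. m k) * qint q (m j))) v u"
proof (cases u)
  case Nil
  then have "(\<Sum>j=1..l. m j) = 0" using assms by (simp add: words_def)
  then show ?thesis by (simp add: tsetlin_def Nil)
next
  case (Cons k w)
  let ?y = "\<lambda>j. x j / (q ^ (\<Sum>k=j+1..l. m k) * qint q (m j))"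
  have u: "mset u = word_mset l m" using assms by (simp add: words_eq)
  have weight: "weight_op l m q x f u = ?y k * f u" for f
  proof -
    have "weight_op l m q x f u = (\<Sum>w\<in>{w. mset w = word_mset l m}. if w = u then ?y k * f u else 0)"
      unfolding weight_op_def lin_ext_def words_eq by (rule sum.cong) (auto simp: basis_vec_def Cons)
    then show ?thesis using u by (simp add: finite_mset_eq)
  qed
  have n: "(\<Sum>j=1..l. m j) = Suc (length w)"
    using arg_cong[OF u, of size] by (simp add: size_word_mset Cons)
  have "tsetlin l m q x v u =
      (\<Sum>i=1..Suc (length w). ?y k * fold (hecke_coord q) (rev [1..<i]) v u)"
    unfolding tsetlin_def weight words_eq n using n u
    by (intro sum.cong) (simp_all add: fold_hecke_eq[of _ v v] size_word_mset del: One_nat_def)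
  also have "\<dots> = ?y k * del q w k v"
    unfolding sum_distrib_left[symmetric] Cons sum_hecke_coord ..
  finally show ?thesis by (simp add: Cons)
qed

lemma char_poly_transition_matrix:
  fixes x :: "nat \<Rightarrow> real" and q :: real and m :: "nat \<Rightarrow> nat" and l :: nat
  defines "y \<equiv> \<lambda>j. x j / (q ^ (\<Sum>k=j+1..l. m k) * qint q (m j))" and "M \<equiv> word_mset l m"
  assumes q: "q \<ge> 1" and ws: "distinct ws" "set ws = words l m"
  shows "char_poly (transition_matrix l m q x ws) =
    (\<Prod>A\<in>submsets {} M. [:- eig_mset q y A, 1:] ^ ker_mult q (M - A))"
proof -
  let ?L = "\<Sum>A\<in>submsets {} M. replicate_mset (ker_mult q (M - A)) (eig_mset q y A)"
  \<comment> \<open>With \<open>J\<close> empty no kernel condition remains: this is the whole space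
    on the words.\<close>
  have "ker_space q {} M = {f. \<forall>u. u \<notin> set ws \<longrightarrow> f u = 0}"
    by (simp add: ker_space_def ws words_eq M_def)
  with flag_top_op[OF q, of y "{}" M]
  have fl: "flag (top_op q y) {f. \<forall>u. u \<notin> set ws \<longrightarrow> f u = 0} ?L" by simp
  have "transition_matrix l m q x ws =
      mat (length ws) (length ws) (\<lambda>(r, c). top_op q y (basis_vec (ws ! r)) (ws ! c))"
    unfolding transition_matrix_def y_def using ws(2) nth_mem[of _ ws]
    by (intro eq_matI) (simp_all add: tsetlin_eq)
  then have "char_poly (transition_matrix l m q x ws) = (\<Prod>c\<in>#?L. [:- c, 1:])"
    using flag_char_poly(1)[OF lin_map_top_op fl ws(1)] by simp
  also have "\<dots> = (\<Prod>A\<in>submsets {} M. [:- eig_mset q y A, 1:] ^ ker_mult q (M - A))"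
    by (induction rule: finite_induct[OF finite_submsets[of "{}" M]]) simp_all
  finally show ?thesis .
qed

text \<open>Both sides are the dimension of the space on the words of content \<open>M\<close>, the
  left one as the length of a flag. The eigenvalues do not matter here, so the weights are set to
  zero.\<close>

lemma sum_ker_mult:
  assumes "q \<ge> 1"
  shows "(\<Sum>A\<in>submsets {} M. ker_mult q (M - A)) = card {w. mset w = M}"
proof -
  let ?L = "\<Sum>A\<in>submsets {} M. replicate_mset (ker_mult q (M - A)) (eig_mset q (\<lambda>_. 0) A)"
  obtain ws where ws: "set ws = {w. mset w = M}" "distinct ws"
    using finite_distinct_list[OF finite_mset_eq] by blast
  have "ker_space q {} M = {f. \<forall>u. u \<notin> set ws \<longrightarrow> f u = 0}" by (simp add: ker_space_def ws)
  with flag_top_op[OF assms, of "\<lambda>_. 0" "{}" M]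
  have "flag (top_op q (\<lambda>_. 0)) {f. \<forall>u. u \<notin> set ws \<longrightarrow> f u = 0} ?L" by simp
  from flag_char_poly(2)[OF lin_map_top_op this ws(2)]
  have "size ?L = card {w. mset w = M}" using distinct_card[OF ws(2)] ws(1) by simp
  moreover have "size ?L = (\<Sum>A\<in>submsets {} M. ker_mult q (M - A))"
    by (induction rule: finite_induct[OF finite_submsets[of "{}" M]]) simp_all
  ultimately show ?thesis by simp
qed

section \<open>Counting words without fixed letters\<close>

text \<open>
  Standardisation replaces the occurrences of \<open>k\<close>, from left to right, by the numbers following the
  number of letters below \<open>k\<close>.  It fixes the position of the displayed \<open>k\<close> iff the letters other
  than \<open>k\<close> in front of it are as many as the letters below \<open>k\<close> in the whole word.
\<close>

definition fixes_letter :: "nat list \<Rightarrow> nat \<Rightarrow> bool" where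
  "fixes_letter w k \<longleftrightarrow> (\<exists>u v. w = u @ k # v \<and>
     length (filter (\<lambda>b. b \<noteq> k) u) = length (filter (\<lambda>b. b < k) w))"

text \<open>
  Inserts \<open>j\<close> at the end of the run of \<open>j\<close>'s that follows the first \<open>s\<close> letters different from \<open>j\<close>.
  If \<open>s\<close> counts the letters below \<open>j\<close>, this makes \<open>j\<close> a fixed letter and changes no other one.
\<close>

fun insert_gap :: "nat \<Rightarrow> nat list \<Rightarrow> nat \<Rightarrow> nat list" where
  "insert_gap j [] s = [j]"
| "insert_gap j (b # w) s = (if b = j then b # insert_gap j w s
     else if s = 0 then j # b # w else b # insert_gap j w (s - 1))"

lemma insert_gap_split:
  "s \<le> length (filter (\<lambda>b. b \<noteq> j) w) \<Longrightarrow>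
    \<exists>u v. w = u @ v \<and> insert_gap j w s = u @ j # v \<and> length (filter (\<lambda>b. b \<noteq> j) u) = s"
proof (induction w arbitrary: s)
  case (Cons b w)
  consider "b = j" | "b \<noteq> j" "s = 0" | t where "b \<noteq> j" "s = Suc t" by (cases s) auto
  then show ?case
  proof cases
    case 1
    then have "s \<le> length (filter (\<lambda>b. b \<noteq> j) w)" using Cons.prems by simp
    from Cons.IH[OF this] obtain u v where "w = u @ v" "insert_gap j w s = u @ j # v"
      "length (filter (\<lambda>b. b \<noteq> j) u) = s" by blast
    with 1 show ?thesis by (intro exI[of _ "b # u"] exI[of _ v]) simp
  next
    case 2
    then show ?thesis by (intro exI[of _ "[]"] exI[of _ "b # w"]) simp
  next
    case 3
    then have "t \<le> length (filter (\<lambda>b. b \<noteq> j) w)" using Cons.prems by simp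
    from Cons.IH[OF this] obtain u v where "w = u @ v" "insert_gap j w t = u @ j # v"
      "length (filter (\<lambda>b. b \<noteq> j) u) = t" by blast
    with 3 show ?thesis by (intro exI[of _ "b # u"] exI[of _ v]) simp
  qed
qed simp

text \<open>All places inside a run of \<open>j\<close>'s give the same word, so taking out any
  \<open>j\<close> and reinserting it at its gap restores the word.\<close>

lemma insert_gap_append:
  "insert_gap j (u @ v) (length (filter (\<lambda>b. b \<noteq> j) u)) = u @ j # v"
proof (induction u)
  case Nil
  show ?case by (induction v) auto
qed simp

lemma mset_insert_gap: "mset (insert_gap j w s) = add_mset j (mset w)"
  by (induction j w s rule: insert_gap.induct) auto

lemma length_insert_gap: "length (insert_gap j w s) = Suc (length w)"
  using arg_cong[OF mset_insert_gap, of size] by simp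

lemma insert_gap_inj: "insert_gap j w s = insert_gap j w' s \<Longrightarrow> w = w'"
proof (induction w arbitrary: w' s)
  case Nil
  from arg_cong[OF this, of length] show ?case unfolding length_insert_gap by simp
next
  case (Cons b w)
  have hd: "\<exists>y. insert_gap j x 0 = j # y" for x by (cases x) auto
  show ?case
  proof (cases w')
    case Nil
    then show ?thesis using arg_cong[OF Cons.prems, of length] unfolding length_insert_gap by simp
  next
    case (Cons b' v)
    then show ?thesis using Cons.prems Cons.IH[of s v] Cons.IH[of "s - 1" v] hd[of w] hd[of v]
      by (auto split: if_splits)
  qed
qed

lemma length_filter_neq: "length (filter (\<lambda>b. b \<noteq> k) xs) + count_list xs k = length xs"
  by (induction xs) auto

lemma length_filter_less_mono:
  "(k :: nat) < j \<Longrightarrow>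
    length (filter (\<lambda>b. b < k) xs) + count_list xs k \<le> length (filter (\<lambda>b. b < j) xs)"
  by (induction xs) auto

text \<open>By \<open>s\<close> the inserted \<open>j\<close> is itself fixed, and fixed letters
  appear in increasing order. So a fixed \<open>k\<close> in front of it is smaller and keeps both
  of its counts, while one behind it is larger and has both counts raised by one.\<close>

lemma fixes_letter_insert:
  assumes kj: "k \<noteq> j" and s: "length (filter (\<lambda>b. b \<noteq> j) u) = length (filter (\<lambda>b. b < j) (u @ v))"
  shows "fixes_letter (u @ j # v) k \<longleftrightarrow> fixes_letter (u @ v) k"
proof
  assume "fixes_letter (u @ j # v) k"
  then obtain a b where ab: "u @ j # v = a @ k # b"
    and fix_k: "length (filter (\<lambda>b. b \<noteq> k) a) = length (filter (\<lambda>b. b < k) (u @ j # v))"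
    unfolding fixes_letter_def by blast
  from ab consider c where "u = a @ k # c" "b = c @ j # v" | c where "v = c @ k # b" "a = u @ j # c"
    using kj by (auto simp: append_eq_append_conv2 Cons_eq_append_conv append_eq_Cons_conv)
  then show "fixes_letter (u @ v) k"
  proof cases
    case 1
    \<comment> \<open>Otherwise the letters below \<open>k\<close> would include every
      \<open>j\<close> and, by \<open>s\<close>, as many others as \<open>u\<close> has letters
      different from \<open>j\<close>: more than the length of \<open>a\<close>.\<close>
    have "\<not> j < k"
    proof
      assume "j < k"
      then show False
        using length_filter_less_mono[of j k "u @ j # v"] length_filter_neq[of j a]
          length_filter_neq[of k a] fix_k s kj unfolding 1 by auto
    qed
    then show ?thesis using fix_k unfolding fixes_letter_def 1
      by (intro exI[of _ a] exI[of _ "c @ v"]) simp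
  next
    case 2
    have "\<not> k < j"
    proof
      assume "k < j"
      then show False
        using length_filter_less_mono[of k j "u @ v"] length_filter_neq[of j u]
          length_filter_neq[of k u] fix_k s kj unfolding 2 by auto
    qed
    then show ?thesis using fix_k kj unfolding fixes_letter_def 2
      by (intro exI[of _ "u @ c"] exI[of _ b]) simp
  qed
next
  assume "fixes_letter (u @ v) k"
  then obtain a b where ab: "u @ v = a @ k # b"
    and fix_k: "length (filter (\<lambda>b. b \<noteq> k) a) = length (filter (\<lambda>b. b < k) (u @ v))"
    unfolding fixes_letter_def by blast
  from ab consider c where "u = a @ k # c" "b = c @ v" | c where "v = c @ k # b" "a = u @ c"
    by (auto simp: append_eq_append_conv2 Cons_eq_append_conv append_eq_Cons_conv)
  then show "fixes_letter (u @ j # v) k"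
  proof cases
    case 1
    have "\<not> j < k"
    proof
      assume "j < k"
      then show False
        using length_filter_less_mono[of j k "u @ v"] length_filter_neq[of j a]
          length_filter_neq[of k a] fix_k s kj unfolding 1 by auto
    qed
    then show ?thesis using fix_k unfolding fixes_letter_def 1
      by (intro exI[of _ a] exI[of _ "c @ j # v"]) simp
  next
    case 2
    have "\<not> k < j"
    proof
      assume "k < j"
      then show False
        using length_filter_less_mono[of k j "u @ v"] length_filter_neq[of j u]
          length_filter_neq[of k u] fix_k s kj unfolding 2 by auto
    qed
    then show ?thesis using fix_k kj unfolding fixes_letter_def 2
      by (intro exI[of _ "u @ j # c"] exI[of _ b]) simp
  qed
qed

definition deranged_words :: "nat set \<Rightarrow> nat multiset \<Rightarrow> nat list set" where
  "deranged_words J M = {w. mset w = M \<and> (\<forall>k\<in>J. \<not> fixes_letter w k)}"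

lemma finite_deranged_words: "finite (deranged_words J M)"
  by (rule finite_subset[OF _ finite_mset_eq[of M]]) (auto simp: deranged_words_def)

text \<open>Words of \<open>deranged_words J M\<close> in which \<open>j\<close> is not fixed either
  give the first summand. The others arise from content \<open>M - {#j#}\<close> by inserting a
  fixed \<open>j\<close>, which does not affect the condition for \<open>J\<close>.\<close>

lemma card_deranged_words_split:
  assumes "j \<in># M" "j \<notin> J"
  shows "card (deranged_words J M) =
    card (deranged_words (insert j J) M) + card (deranged_words J (M - {#j#}))"
proof -
  \<comment> \<open>The gap at which an inserted \<open>j\<close> becomes fixed; removing a
    \<open>j\<close> leaves this number unchanged.\<close>
  define s where "s = size (filter_mset (\<lambda>b. b < j) M)"
  define F where "F = {w \<in> deranged_words J M. fixes_letter w j}"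
  have sub: "filter_mset (\<lambda>b. b < j) (M - {#j#}) = filter_mset (\<lambda>b. b < j) M"
    by (simp add: filter_diff_mset)
  have len: "length (filter (\<lambda>b. b < j) w) = s" if "mset w = M \<or> mset w = M - {#j#}" for w
    using that sub by (auto simp: s_def size_mset[symmetric] mset_filter simp del: size_mset)
  have "(\<lambda>w. insert_gap j w s) ` deranged_words J (M - {#j#}) = F"
  proof (intro equalityI subsetI)
    fix w assume "w \<in> (\<lambda>w. insert_gap j w s) ` deranged_words J (M - {#j#})"
    then obtain w' where w': "w' \<in> deranged_words J (M - {#j#})" "w = insert_gap j w' s" by auto
    have m: "mset w' = M - {#j#}" using w' by (simp add: deranged_words_def)
    have "s \<le> length (filter (\<lambda>b. b \<noteq> j) w')"
      using length_filter_less_mono[of j "Suc j"] unfolding len[OF disjI2[OF m], symmetric]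
      by (induction w') auto
    then obtain u v where uv: "w' = u @ v" "w = u @ j # v" "length (filter (\<lambda>b. b \<noteq> j) u) = s"
      using insert_gap_split w'(2) by blast
    have eq: "length (filter (\<lambda>b. b \<noteq> j) u) = length (filter (\<lambda>b. b < j) (u @ v))"
      using len[of w'] m uv by simp
    have "mset w = M" using w'(2) m assms(1) by (simp add: mset_insert_gap)
    moreover have "fixes_letter w j"
      unfolding fixes_letter_def uv(2) using eq by (intro exI[of _ u] exI[of _ v]) simp
    moreover have "\<not> fixes_letter w k" if "k \<in> J" for k
      using fixes_letter_insert[OF _ eq, of k] that assms(2) w'(1) uv(1,2)
      by (auto simp: deranged_words_def)
    ultimately show "w \<in> F" by (simp add: F_def deranged_words_def)
  next
    fix w assume w: "w \<in> F"
    then obtain u v where uv: "w = u @ j # v"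
      "length (filter (\<lambda>b. b \<noteq> j) u) = length (filter (\<lambda>b. b < j) w)"
      by (auto simp: F_def fixes_letter_def)
    have m: "mset w = M" using w by (simp add: F_def deranged_words_def)
    then have m': "mset (u @ v) = M - {#j#}" using uv(1) by auto
    have eq: "length (filter (\<lambda>b. b \<noteq> j) u) = length (filter (\<lambda>b. b < j) (u @ v))"
      using uv by simp
    have "w = insert_gap j (u @ v) s"
      using insert_gap_append[of j u v] uv len[of w] m by simp
    moreover have "u @ v \<in> deranged_words J (M - {#j#})"
      using m' w fixes_letter_insert[OF _ eq] assms(2) uv(1)
      by (force simp: F_def deranged_words_def)
    ultimately show "w \<in> (\<lambda>w. insert_gap j w s) ` deranged_words J (M - {#j#})" by blast
  qed
  moreover have "inj_on (\<lambda>w. insert_gap j w s) (deranged_words J (M - {#j#}))"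
    by (auto intro: inj_onI dest: insert_gap_inj)
  ultimately have "card F = card (deranged_words J (M - {#j#}))" by (metis card_image)
  moreover have "deranged_words J M = deranged_words (insert j J) M \<union> F"
    "deranged_words (insert j J) M \<inter> F = {}"
    by (auto simp: F_def deranged_words_def)
  ultimately show ?thesis
    using card_Un_disjoint[of "deranged_words (insert j J) M" F] finite_deranged_words
    by (metis finite_Un)
qed

lemma fixes_letter_in_set: "fixes_letter w k \<Longrightarrow> k \<in> set w"
  by (auto simp: fixes_letter_def)

text \<open>The double induction of \<open>flag_top_op\<close> again, with
  \<open>card_deranged_words_split\<close> in place of the exact sequence of
  \<open>d_k\<close>.\<close>

lemma sum_deranged_words:
  "(\<Sum>A\<in>submsets J M. card (deranged_words UNIV (M - A))) = card (deranged_words J M)"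
proof (induction "size M" arbitrary: J M rule: less_induct)
  case less
  note outer = less.hyps
  show ?case
  proof (induction "card (set_mset M - J)" arbitrary: J rule: less_induct)
    case less
    show ?case
    proof (cases "set_mset M \<subseteq> J")
      case True
      then have "deranged_words J M = deranged_words UNIV M"
        using fixes_letter_in_set by (fastforce simp: deranged_words_def)
      then show ?thesis by (simp add: submsets_trivial[OF True])
    next
      case False
      then obtain k where k: "k \<in># M" "k \<notin> J" by auto
      have "size (M - {#k#}) < size M" using k(1) by (simp add: size_Diff1_less)
      from outer[OF this] have "(\<Sum>A\<in>submsets J (M - {#k#}). card (deranged_words UNIV (M - add_mset k A)))
          = card (deranged_words J (M - {#k#}))" by simp
      moreover have "card (set_mset M - insert k J) < card (set_mset M - J)"
        using k by (intro psubset_card_mono) auto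
      ultimately show ?thesis
        unfolding sum_submsets_split[OF k] card_deranged_words_split[OF k] using less.hyps by simp
    qed
  qed
qed

text \<open>Summed over all submultisets, both quantities give the number of words of content
  \<open>M\<close>. The empty submultiset contributes the term for \<open>M\<close> itself and the
  others concern smaller contents, so induction isolates it.\<close>

lemma ker_mult_eq:
  assumes "q \<ge> 1"
  shows "ker_mult q M = card (deranged_words UNIV M)"
proof (induction "size M" arbitrary: M rule: less_induct)
  case less
  let ?S = "submsets {} M" and ?d = "\<lambda>M. card (deranged_words UNIV M)"
  have "{#} \<in> ?S" by (simp add: submsets_def)
  note rem = sum.remove[OF finite_submsets this]
  have "(\<Sum>A\<in>?S. ker_mult q (M - A)) = (\<Sum>A\<in>?S. ?d (M - A))"
    unfolding sum_ker_mult[OF assms] sum_deranged_words by (simp add: deranged_words_def)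
  moreover have "(\<Sum>A\<in>?S - {{#}}. ker_mult q (M - A)) = (\<Sum>A\<in>?S - {{#}}. ?d (M - A))"
  proof (rule sum.cong)
    fix A assume "A \<in> ?S - {{#}}"
    then have "A \<subseteq># M" "A \<noteq> {#}" by (auto simp: submsets_def)
    then have "size (M - A) < size M"
      by (metis diff_less nonempty_has_size order_less_le_trans size_Diff_submset size_mset_mono)
    then show "ker_mult q (M - A) = ?d (M - A)" by (rule less)
  qed simp
  ultimately show ?case by (simp add: rem)
qed

section \<open>Poset derangements of disjoint chains\<close>

lemma initial_segment:
  fixes D :: "nat set"
  assumes "finite D" "0 \<notin> D" "\<And>x y. x \<in> D \<Longrightarrow> 1 \<le> y \<Longrightarrow> y \<le> x \<Longrightarrow> y \<in> D"
  shows "D = {1..card D}"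
proof (cases "D = {}")
  case False
  have "D = {1..Max D}"
  proof (intro equalityI subsetI)
    fix x assume "x \<in> D"
    then show "x \<in> {1..Max D}" using assms(1,2) by (cases x) auto
  next
    fix x assume "x \<in> {1..Max D}"
    then show "x \<in> D" using assms(3)[of "Max D" x] Max_in[OF assms(1) False] by simp
  qed
  then show ?thesis by (metis card_atLeastAtMost diff_Suc_1)
qed simp

lemma length_filter_take_less:
  assumes "i < j" "j \<le> length w" "P (w ! i)"
  shows "length (filter P (take i w)) < length (filter P (take j w))"
proof -
  have "take j w = take i w @ w ! i # drop (Suc i) (take j w)"
    using id_take_nth_drop[of i "take j w"] assms by (simp add: min_def)
  then have "length (filter P (take j w)) =
      length (filter P (take i w @ w ! i # drop (Suc i) (take j w)))" by simp
  then show ?thesis using assms(3) by simp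
qed

lemma fixes_letter_iff_nth:
  "fixes_letter w k \<longleftrightarrow> (\<exists>i<length w. w ! i = k \<and>
     length (filter (\<lambda>b. b \<noteq> k) (take i w)) = length (filter (\<lambda>b. b < k) w))"
proof
  assume "fixes_letter w k"
  then obtain u v where "w = u @ k # v"
    "length (filter (\<lambda>b. b \<noteq> k) u) = length (filter (\<lambda>b. b < k) w)"
    unfolding fixes_letter_def by blast
  then show "\<exists>i<length w. w ! i = k \<and>
     length (filter (\<lambda>b. b \<noteq> k) (take i w)) = length (filter (\<lambda>b. b < k) w)"
    by (intro exI[of _ "length u"]) simp
next
  assume "\<exists>i<length w. w ! i = k \<and>
     length (filter (\<lambda>b. b \<noteq> k) (take i w)) = length (filter (\<lambda>b. b < k) w)"
  then obtain i where i: "i < length w" "w ! i = k"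
    "length (filter (\<lambda>b. b \<noteq> k) (take i w)) = length (filter (\<lambda>b. b < k) w)" by blast
  then have "w = take i w @ k # drop (Suc i) w" using id_take_nth_drop by blast
  with i(3) show "fixes_letter w k" unfolding fixes_letter_def by blast
qed

text \<open>
  Linear extensions of the disjoint union of chains on \<open>{1..N}\<close> whose elements \<open>p\<close> carry the chain
  label \<open>\<gamma> p\<close>.
\<close>

definition block_extensions :: "nat \<Rightarrow> (nat \<Rightarrow> nat) \<Rightarrow> nat list set" where
  "block_extensions N \<gamma> = {\<pi>. distinct \<pi> \<and> set \<pi> = {1..N} \<and>
     (\<forall>i<length \<pi>. \<forall>k<length \<pi>. \<pi> ! i \<le> \<pi> ! k \<and> \<gamma> (\<pi> ! i) = \<gamma> (\<pi> ! k) \<longrightarrow> i \<le> k)}"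

text \<open>The value given to position \<open>i\<close> by standardisation, with positions counted
  from 0 and values from 1.\<close>

definition std :: "nat list \<Rightarrow> nat \<Rightarrow> nat" where
  "std w i = length (filter (\<lambda>b. b < w ! i) w) + Suc (length (filter (\<lambda>b. b = w ! i) (take i w)))"

text \<open>Count the values up to \<open>\<pi> ! i\<close>: by monotonicity they are all elements
  of lower chains, together with the elements of the same chain standing no later than position
  \<open>i\<close>, since a chain is listed in increasing order.\<close>

lemma block_extensions_nth:
  assumes mono: "\<And>x y. x \<le> y \<Longrightarrow> 1 \<le> x \<Longrightarrow> y \<le> N \<Longrightarrow> \<gamma> x \<le> \<gamma> y"
    and \<pi>: "\<pi> \<in> block_extensions N \<gamma>" and i: "i < length \<pi>"
  shows "\<pi> ! i = std (map \<gamma> \<pi>) i"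
proof -
  let ?k = "\<gamma> (\<pi> ! i)"
  have d: "distinct \<pi>" and s: "set \<pi> = {1..N}"
    and o: "\<And>i k. i < length \<pi> \<Longrightarrow> k < length \<pi> \<Longrightarrow> \<pi> ! i \<le> \<pi> ! k \<Longrightarrow> \<gamma> (\<pi> ! i) = \<gamma> (\<pi> ! k) \<Longrightarrow> i \<le> k"
    using \<pi> by (auto simp: block_extensions_def)
  have rng: "1 \<le> \<pi> ! i" "\<pi> ! i \<le> N" using s i nth_mem[of i \<pi>] by auto
  have "{1..\<pi> ! i} = set (filter (\<lambda>p. \<gamma> p < ?k) \<pi>) \<union> set (filter (\<lambda>p. \<gamma> p = ?k) (take (Suc i) \<pi>))"
  proof (intro equalityI subsetI)
    fix p assume p: "p \<in> {1..\<pi> ! i}"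
    then have "p \<in> set \<pi>" "\<gamma> p \<le> ?k" using rng s mono[of p "\<pi> ! i"] by auto
    then obtain c where c: "c < length \<pi>" "p = \<pi> ! c" by (metis in_set_conv_nth)
    show "p \<in> set (filter (\<lambda>p. \<gamma> p < ?k) \<pi>) \<union> set (filter (\<lambda>p. \<gamma> p = ?k) (take (Suc i) \<pi>))"
    proof (cases "\<gamma> p = ?k")
      case True
      then have "c \<le> i" using o[of c i] c i p by simp
      then have "p \<in> set (take (Suc i) \<pi>)" using c i nth_mem[of c "take (Suc i) \<pi>"] by simp
      then show ?thesis using True by simp
    qed (use \<open>p \<in> set \<pi>\<close> \<open>\<gamma> p \<le> ?k\<close> in auto)
  next
    fix p assume "p \<in> set (filter (\<lambda>p. \<gamma> p < ?k) \<pi>) \<union> set (filter (\<lambda>p. \<gamma> p = ?k) (take (Suc i) \<pi>))"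
    then consider "p \<in> set \<pi>" "\<gamma> p < ?k" | "p \<in> set (take (Suc i) \<pi>)" "\<gamma> p = ?k" by auto
    then show "p \<in> {1..\<pi> ! i}"
    proof cases
      case 1
      then have "\<not> \<pi> ! i \<le> p" using mono[of "\<pi> ! i" p] rng s by auto
      then show ?thesis using 1(1) s by auto
    next
      case 2
      then obtain c where c: "c \<le> i" "p = \<pi> ! c" using i by (auto simp: in_set_conv_nth less_Suc_eq_le)
      then have "p \<le> \<pi> ! i" using o[of i c] 2(2) c i by (cases "\<pi> ! i \<le> \<pi> ! c") auto
      moreover have "p \<in> set \<pi>" using c i by auto
      ultimately show ?thesis using s by auto
    qed
  qed
  then have "card {1..\<pi> ! i} =
      card (set (filter (\<lambda>p. \<gamma> p < ?k) \<pi>) \<union> set (filter (\<lambda>p. \<gamma> p = ?k) (take (Suc i) \<pi>)))" by simp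
  also have "\<dots> = card (set (filter (\<lambda>p. \<gamma> p < ?k) \<pi>)) + card (set (filter (\<lambda>p. \<gamma> p = ?k) (take (Suc i) \<pi>)))"
    by (rule card_Un_disjoint) auto
  also have "\<dots> = length (filter (\<lambda>p. \<gamma> p < ?k) \<pi>) + length (filter (\<lambda>p. \<gamma> p = ?k) (take (Suc i) \<pi>))"
    using d by (simp only: distinct_card distinct_filter distinct_take)
  also have "\<dots> = std (map \<gamma> \<pi>) i"
    using i by (simp add: std_def take_Suc_conv_app_nth take_map filter_map o_def)
  finally show ?thesis by simp
qed

lemma length_block_extensions: "\<pi> \<in> block_extensions N \<gamma> \<Longrightarrow> length \<pi> = N"
  using distinct_card by (fastforce simp: block_extensions_def)

text \<open>Standardisation is the inverse: \<open>block_extensions_nth\<close> gives injectivity,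
  and \<open>std\<close> applied to a word of the right content is a linear extension.\<close>

lemma bij_betw_block_extensions:
  assumes mono: "\<And>x y. x \<le> y \<Longrightarrow> 1 \<le> x \<Longrightarrow> y \<le> N \<Longrightarrow> \<gamma> x \<le> \<gamma> y"
  shows "bij_betw (map \<gamma>) (block_extensions N \<gamma>) {w. mset w = image_mset \<gamma> (mset_set {1..N})}"
  unfolding bij_betw_def
proof (intro conjI inj_onI equalityI subsetI)
  fix \<pi> \<pi>' assume a: "\<pi> \<in> block_extensions N \<gamma>" "\<pi>' \<in> block_extensions N \<gamma>" "map \<gamma> \<pi> = map \<gamma> \<pi>'"
  show "\<pi> = \<pi>'"
  proof (rule nth_equalityI)
    show "length \<pi> = length \<pi>'" using a length_block_extensions by metis
    then show "\<pi> ! i = \<pi>' ! i" if "i < length \<pi>" for i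
      using that block_extensions_nth[OF mono a(1)] block_extensions_nth[OF mono a(2)] a(3) by simp
  qed
next
  fix w assume "w \<in> map \<gamma> ` block_extensions N \<gamma>"
  then obtain \<pi> where "w = map \<gamma> \<pi>" "distinct \<pi>" "set \<pi> = {1..N}"
    by (auto simp: block_extensions_def)
  moreover from this have "mset \<pi> = mset_set {1..N}" by (metis mset_set_set)
  ultimately show "w \<in> {w. mset w = image_mset \<gamma> (mset_set {1..N})}" by simp
next
  fix w assume "w \<in> {w. mset w = image_mset \<gamma> (mset_set {1..N})}"
  then have w: "mset w = image_mset \<gamma> (mset_set {1..N})" by simp
  have len: "length w = N" using arg_cong[OF w, of size] by simp
  \<comment> \<open>For \<open>Q\<close> closed downwards, monotone labels make this set an initial
    segment, whose length can be read off from \<open>w\<close>.\<close>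
  have filt: "{p \<in> {1..N}. Q (\<gamma> p)} = {1..length (filter Q w)}"
    if "\<And>a b. a \<le> b \<Longrightarrow> Q b \<Longrightarrow> Q a" for Q
  proof -
    have "length (filter Q w) = size (filter_mset Q (mset w))" by (metis mset_filter size_mset)
    also have "\<dots> = card {p \<in> {1..N}. Q (\<gamma> p)}"
      unfolding w by (simp add: filter_mset_image_mset filter_mset_mset_set)
    finally have "length (filter Q w) = card {p \<in> {1..N}. Q (\<gamma> p)}" .
    moreover have "{p \<in> {1..N}. Q (\<gamma> p)} = {1..card {p \<in> {1..N}. Q (\<gamma> p)}}"
      using that mono by (intro initial_segment) auto
    ultimately show ?thesis by simp
  qed
  have std_range: "1 \<le> std w i" "std w i \<le> N" "\<gamma> (std w i) = w ! i" if i: "i < N" for i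
  proof -
    let ?k = "w ! i"
    have "length (filter (\<lambda>b. b \<le> ?k) xs) =
        length (filter (\<lambda>b. b < ?k) xs) + length (filter (\<lambda>b. b = ?k) xs)" for xs
      by (induction xs) auto
    moreover have "length (filter (\<lambda>b. b = ?k) (take i w)) < length (filter (\<lambda>b. b = ?k) w)"
      using length_filter_take_less[of i "length w" w "\<lambda>b. b = ?k"] i len by simp
    ultimately have le: "std w i \<le> length (filter (\<lambda>b. b \<le> ?k) w)" by (simp add: std_def)
    show 1: "1 \<le> std w i" by (simp add: std_def)
    show 2: "std w i \<le> N" using le length_filter_le[of "\<lambda>b. b \<le> ?k" w] len by linarith
    have "{p \<in> {1..N}. \<gamma> p \<le> ?k} = {1..length (filter (\<lambda>b. b \<le> ?k) w)}"
      by (rule filt) simp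
    then have "std w i \<in> {p \<in> {1..N}. \<gamma> p \<le> ?k}" using le 1 by (simp only: atLeastAtMost_iff)
    moreover have "{p \<in> {1..N}. \<gamma> p < ?k} = {1..length (filter (\<lambda>b. b < ?k) w)}"
      by (rule filt) simp
    then have "std w i \<notin> {p \<in> {1..N}. \<gamma> p < ?k}" by (simp only: atLeastAtMost_iff) (simp add: std_def)
    ultimately show "\<gamma> (std w i) = ?k" by simp
  qed
  have std_less: "std w i < std w j" if "i < j" "j < N" "w ! i = w ! j" for i j
    using length_filter_take_less[of i j w "\<lambda>b. b = w ! j"] that len by (simp add: std_def)
  let ?\<pi> = "map (std w) [0..<N]"
  have "inj_on (std w) {0..<N}"
  proof (rule inj_onI)
    fix i j assume ij: "i \<in> {0..<N}" "j \<in> {0..<N}" "std w i = std w j"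
    then have "w ! i = w ! j" using std_range(3)[of i] std_range(3)[of j] by simp
    then show "i = j" using std_less[of i j] std_less[of j i] ij by (cases i j rule: linorder_cases) auto
  qed
  then have d: "distinct ?\<pi>" by (simp add: distinct_map)
  have "set ?\<pi> = {1..N}"
  proof (rule card_subset_eq)
    show "set ?\<pi> \<subseteq> {1..N}" using std_range by auto
    show "card (set ?\<pi>) = card {1..N}" unfolding distinct_card[OF d] by simp
  qed simp
  moreover have "i \<le> k" if "i < N" "k < N" "std w i \<le> std w k" "\<gamma> (std w i) = \<gamma> (std w k)" for i k
    using std_less[of k i] that std_range(3)[of i] std_range(3)[of k] by (cases "k < i") auto
  ultimately have "?\<pi> \<in> block_extensions N \<gamma>" using d by (simp add: block_extensions_def)
  moreover have "map \<gamma> ?\<pi> = w" using std_range(3) len by (intro nth_equalityI) auto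
  ultimately show "w \<in> map \<gamma> ` block_extensions N \<gamma>" by (metis imageI)
qed

text \<open>The \<open>i\<close> letters in front split into those equal to \<open>w ! i\<close>,
  which cancel against \<open>std\<close>, and the rest. This links fixed points to
  \<open>fixes_letter\<close>.\<close>

lemma std_eq_Suc_iff:
  assumes "i < length w"
  shows "std w i = Suc i \<longleftrightarrow>
    length (filter (\<lambda>b. b \<noteq> w ! i) (take i w)) = length (filter (\<lambda>b. b < w ! i) w)"
  using sum_length_filter_compl[of "\<lambda>b. b = w ! i" "take i w"] assms by (auto simp: std_def)

lemma card_block_derangements:
  assumes mono: "\<And>x y. x \<le> y \<Longrightarrow> 1 \<le> x \<Longrightarrow> y \<le> N \<Longrightarrow> \<gamma> x \<le> \<gamma> y"
  shows "card {\<pi> \<in> block_extensions N \<gamma>. \<forall>i\<in>{1..length \<pi>}. \<pi> ! (i - 1) \<noteq> i} =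
    card (deranged_words UNIV (image_mset \<gamma> (mset_set {1..N})))"
proof (rule bij_betw_same_card)
  let ?L = "block_extensions N \<gamma>" and ?W = "{w. mset w = image_mset \<gamma> (mset_set {1..N})}"
  have iff: "(\<forall>i\<in>{1..length \<pi>}. \<pi> ! (i - 1) \<noteq> i) \<longleftrightarrow> (\<forall>k. \<not> fixes_letter (map \<gamma> \<pi>) k)"
    if "\<pi> \<in> ?L" for \<pi>
  proof -
    have "(\<forall>i\<in>{1..length \<pi>}. \<pi> ! (i - 1) \<noteq> i) \<longleftrightarrow> (\<forall>i<length \<pi>. \<pi> ! i \<noteq> Suc i)"
      by (auto simp: Ball_def) (metis Suc_leI Suc_pred diff_Suc_1 less_Suc_eq_le zero_less_Suc
          Suc_le_eq)+
    also have "\<dots> \<longleftrightarrow> (\<forall>i<length \<pi>. std (map \<gamma> \<pi>) i \<noteq> Suc i)"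
      using block_extensions_nth[OF mono that] by auto
    also have "\<dots> \<longleftrightarrow> (\<forall>k. \<not> fixes_letter (map \<gamma> \<pi>) k)"
      unfolding fixes_letter_iff_nth using std_eq_Suc_iff[of _ "map \<gamma> \<pi>"] by auto
    finally show ?thesis .
  qed
  note bij = bij_betw_block_extensions[of N \<gamma>, OF mono]
  show "bij_betw (map \<gamma>) {\<pi> \<in> ?L. \<forall>i\<in>{1..length \<pi>}. \<pi> ! (i - 1) \<noteq> i}
      (deranged_words UNIV (image_mset \<gamma> (mset_set {1..N})))"
    unfolding bij_betw_def
  proof
    show "inj_on (map \<gamma>) {\<pi> \<in> ?L. \<forall>i\<in>{1..length \<pi>}. \<pi> ! (i - 1) \<noteq> i}"
      using bij_betw_imp_inj_on[OF bij] by (rule inj_on_subset) auto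
    have "map \<gamma> ` {\<pi> \<in> ?L. \<forall>i\<in>{1..length \<pi>}. \<pi> ! (i - 1) \<noteq> i} =
        {w \<in> map \<gamma> ` ?L. \<forall>k. \<not> fixes_letter w k}"
      using iff by blast
    also have "\<dots> = deranged_words UNIV (image_mset \<gamma> (mset_set {1..N}))"
      using bij_betw_imp_surj_on[OF bij] unfolding deranged_words_def by blast
    finally show "map \<gamma> ` {\<pi> \<in> ?L. \<forall>i\<in>{1..length \<pi>}. \<pi> ! (i - 1) \<noteq> i} =
        deranged_words UNIV (image_mset \<gamma> (mset_set {1..N}))" .
  qed
qed

section \<open>Relabelled posets and disjoint chains\<close>

lemma bij_betw_relabel:
  assumes "finite A"
  shows "bij_betw (relabel A) A {1..card A}"
    and "x \<in> A \<Longrightarrow> y \<in> A \<Longrightarrow> relabel A x \<le> relabel A y \<longleftrightarrow> x \<le> y"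
proof -
  have less: "relabel A x < relabel A y" if "x < y" "y \<in> A" for x y
  proof -
    have "y \<in> {z \<in> A. z \<le> y} - {z \<in> A. z \<le> x}" using that by simp
    moreover have "{z \<in> A. z \<le> x} \<subseteq> {z \<in> A. z \<le> y}" using that by auto
    ultimately have "{z \<in> A. z \<le> x} \<subset> {z \<in> A. z \<le> y}" by blast
    then show ?thesis unfolding relabel_def using assms by (intro psubset_card_mono) auto
  qed
  have inj: "inj_on (relabel A) A"
  proof (rule inj_onI)
    fix x y assume "x \<in> A" "y \<in> A" "relabel A x = relabel A y"
    then show "x = y" using less[of x y] less[of y x] by (cases x y rule: linorder_cases) auto
  qed
  moreover have "relabel A ` A = {1..card A}"
  proof (rule card_subset_eq)
    show "relabel A ` A \<subseteq> {1..card A}"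
    proof
      fix p assume "p \<in> relabel A ` A"
      then obtain x where x: "x \<in> A" "p = card {y \<in> A. y \<le> x}" by (auto simp: relabel_def)
      have "0 < card {y \<in> A. y \<le> x}" using x(1) assms by (auto simp: card_gt_0_iff)
      moreover have "card {y \<in> A. y \<le> x} \<le> card A" using assms by (intro card_mono) auto
      ultimately show "p \<in> {1..card A}" using x(2) by simp
    qed
  qed (simp_all add: card_image inj)
  ultimately show "bij_betw (relabel A) A {1..card A}" by (simp add: bij_betw_def)
  show "relabel A x \<le> relabel A y \<longleftrightarrow> x \<le> y" if "x \<in> A" "y \<in> A"
    using less[of x y] less[of y x] that by (cases x y rule: linorder_cases) auto
qed

text \<open>Relabelling is an order isomorphism onto \<open>{1..card A}\<close>, so transporting the
  chain label \<open>\<beta>\<close> reduces the count to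
  \<open>card_block_derangements\<close>.\<close>

lemma card_poset_derangements:
  assumes A: "finite A"
    and r: "\<And>x y. x \<in> A \<Longrightarrow> y \<in> A \<Longrightarrow> (x, y) \<in> r \<longleftrightarrow> x \<le> y \<and> \<beta> x = \<beta> y"
    and mono: "\<And>x y. x \<in> A \<Longrightarrow> y \<in> A \<Longrightarrow> x \<le> y \<Longrightarrow> \<beta> x \<le> \<beta> y"
  shows "card (poset_derangements A r) = card (deranged_words UNIV (image_mset \<beta> (mset_set A)))"
proof -
  define g where "g = inv_into A (relabel A)"
  define \<gamma> where "\<gamma> = (\<lambda>p. \<beta> (g p))"
  let ?N = "card A"
  note bij = bij_betw_relabel(1)[OF A]
  have g: "bij_betw g {1..?N} A" unfolding g_def by (rule bij_betw_inv_into[OF bij])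
  have gA: "g p \<in> A" if "p \<in> {1..?N}" for p using bij_betw_apply[OF g that] .
  have rg: "relabel A (g p) = p" if "p \<in> {1..?N}" for p
    unfolding g_def using bij_betw_inv_into_right[OF bij that] .
  have gr: "g (relabel A x) = x" if "x \<in> A" for x
    unfolding g_def using bij_betw_inv_into_left[OF bij that] .
  have g_mono: "g p \<le> g p' \<longleftrightarrow> p \<le> p'" if "p \<in> {1..?N}" "p' \<in> {1..?N}" for p p'
    using bij_betw_relabel(2)[OF A gA gA, OF that] rg that by simp
  have ord: "(p, p') \<in> relabeled_order A r \<longleftrightarrow> p \<le> p' \<and> \<gamma> p = \<gamma> p'"
    if p: "p \<in> {1..?N}" "p' \<in> {1..?N}" for p p'
  proof
    assume "(p, p') \<in> relabeled_order A r"
    then obtain x y where xy: "x \<in> A" "y \<in> A" "(x, y) \<in> r" "p = relabel A x" "p' = relabel A y"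
      by (auto simp: relabeled_order_def)
    then show "p \<le> p' \<and> \<gamma> p = \<gamma> p'"
      using r[of x y] bij_betw_relabel(2)[OF A, of x y] gr by (simp add: \<gamma>_def)
  next
    assume "p \<le> p' \<and> \<gamma> p = \<gamma> p'"
    then have "(g p, g p') \<in> r" using r[OF gA gA, OF p] g_mono[OF p] by (simp add: \<gamma>_def)
    then have "(relabel A (g p), relabel A (g p')) \<in> relabeled_order A r"
      using gA[OF p(1)] gA[OF p(2)] unfolding relabeled_order_def by blast
    then show "(p, p') \<in> relabeled_order A r" by (simp only: rg[OF p(1)] rg[OF p(2)])
  qed
  have "linear_extensions A r = block_extensions ?N \<gamma>"
  proof -
    have "(\<forall>i<length \<pi>. \<forall>k<length \<pi>. (\<pi> ! i, \<pi> ! k) \<in> relabeled_order A r \<longrightarrow> i \<le> k) \<longleftrightarrow>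
        (\<forall>i<length \<pi>. \<forall>k<length \<pi>. \<pi> ! i \<le> \<pi> ! k \<and> \<gamma> (\<pi> ! i) = \<gamma> (\<pi> ! k) \<longrightarrow> i \<le> k)"
      if "set \<pi> = {1..?N}" for \<pi>
    proof -
      have "(\<pi> ! i, \<pi> ! k) \<in> relabeled_order A r \<longleftrightarrow> \<pi> ! i \<le> \<pi> ! k \<and> \<gamma> (\<pi> ! i) = \<gamma> (\<pi> ! k)"
        if "i < length \<pi>" "k < length \<pi>" for i k
        by (rule ord) (use \<open>set \<pi> = {1..?N}\<close> nth_mem that in blast)+
      then show ?thesis by blast
    qed
    then show ?thesis unfolding linear_extensions_def block_extensions_def by blast
  qed
  moreover have "\<gamma> p \<le> \<gamma> p'" if "p \<le> p'" "1 \<le> p" "p' \<le> ?N" for p p'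
  proof -
    have p: "p \<in> {1..?N}" "p' \<in> {1..?N}" using that by auto
    show ?thesis unfolding \<gamma>_def using mono[OF gA gA, OF p] g_mono[OF p] that(1) by blast
  qed
  ultimately have "card (poset_derangements A r) =
      card (deranged_words UNIV (image_mset \<gamma> (mset_set {1..?N})))"
    using card_block_derangements[of ?N \<gamma>] by (simp only: poset_derangements_def)
  also have "image_mset \<gamma> (mset_set {1..?N}) = image_mset \<beta> (image_mset g (mset_set {1..?N}))"
    by (simp add: \<gamma>_def image_mset.compositionality o_def)
  also have "image_mset g (mset_set {1..?N}) = mset_set A"
    using image_mset_mset_set[of g "{1..?N}"] g by (simp add: bij_betw_def)
  finally show ?thesis .
qed

lemma partial_sum_mono: "i \<le> j \<Longrightarrow> partial_sum m i \<le> partial_sum m j"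
  unfolding partial_sum_def by (intro sum_mono2) auto

lemma partial_sum_pred: "0 < j \<Longrightarrow> partial_sum m j = partial_sum m (j - 1) + m j"
  by (cases j) (simp_all add: partial_sum_def)

definition block_of :: "(nat \<Rightarrow> nat) \<Rightarrow> nat \<Rightarrow> nat" where
  "block_of m p = (LEAST j. p \<le> partial_sum m j)"

lemma block_of_eq:
  assumes "p \<in> chain_block m j" "0 < j"
  shows "block_of m p = j"
  unfolding block_of_def
proof (rule Least_equality)
  show "p \<le> partial_sum m j" using assms(1) by (simp add: chain_block_def)
  show "j \<le> i" if "p \<le> partial_sum m i" for i
    using that assms partial_sum_mono[of i "j - 1" m] by (fastforce simp: chain_block_def)
qed

lemma mem_chain_block:
  assumes "1 \<le> p" "p \<le> partial_sum m l"
  shows "\<exists>j\<in>{1..l}. p \<in> chain_block m j"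
  using assms
proof (induction l)
  case (Suc l)
  then show ?case
    by (cases "p \<le> partial_sum m l") (force simp: chain_block_def)+
qed (simp add: partial_sum_def)

lemma card_chain_derangements:
  assumes a: "\<And>j. j \<in> {1..l} \<Longrightarrow> a j \<le> m j" and n: "(\<Sum>j=1..l. m j) = n"
  shows "card (poset_derangements ({1..n} - upper_set l m a) (chains_order l m)) =
    card (deranged_words UNIV (word_mset l (\<lambda>j. m j - a j)))"
proof -
  let ?A = "{1..n} - upper_set l m a"
  have n': "n = partial_sum m l" using n by (simp add: partial_sum_def)
  have cb: "\<exists>j\<in>{1..l}. p \<in> chain_block m j" if "p \<in> ?A" for p
    using that n' by (intro mem_chain_block) auto
  have bo: "block_of m p = j" if "p \<in> chain_block m j" "j \<in> {1..l}" for p j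
    using block_of_eq that by auto
  have 1: "(p, p') \<in> chains_order l m \<longleftrightarrow> p \<le> p' \<and> block_of m p = block_of m p'"
    if A: "p \<in> ?A" "p' \<in> ?A" for p p'
  proof -
    obtain j j' where j: "j \<in> {1..l}" "p \<in> chain_block m j" "j' \<in> {1..l}" "p' \<in> chain_block m j'"
      using cb[OF A(1)] cb[OF A(2)] by blast
    have "(\<exists>i\<in>{1..l}. p \<in> chain_block m i \<and> p' \<in> chain_block m i) \<longleftrightarrow> j = j'"
      using bo j by metis
    then show ?thesis unfolding chains_order_def bo[OF j(2,1)] bo[OF j(4,3)] by simp
  qed
  have 2: "block_of m p \<le> block_of m p'" if "p \<in> ?A" "p' \<in> ?A" "p \<le> p'" for p p'
  proof -
    from cb[OF that(2)] obtain j where "p' \<le> partial_sum m j" "block_of m p' = j"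
      using bo by (auto simp: chain_block_def)
    then show ?thesis using that(3) by (auto simp: block_of_def[of m p] intro!: Least_le)
  qed
  \<comment> \<open>Deleting the top \<open>a j\<close> elements leaves the lowest
    \<open>m j - a j\<close> of each chain; the chain blocks are disjoint, so no other chain
    interferes.\<close>
  have A: "?A = (\<Union>j\<in>{1..l}. {partial_sum m (j - 1) + 1..partial_sum m (j - 1) + (m j - a j)})"
  proof (intro equalityI subsetI)
    fix p assume p: "p \<in> ?A"
    then obtain j where j: "j \<in> {1..l}" "p \<in> chain_block m j" using cb by blast
    then have "\<not> partial_sum m j - a j + 1 \<le> p" using p by (force simp: upper_set_def chain_block_def)
    then show "p \<in> (\<Union>j\<in>{1..l}. {partial_sum m (j - 1) + 1..partial_sum m (j - 1) + (m j - a j)})"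
      using j a[of j] partial_sum_pred[of j m]
      by (intro UN_I[of j]) (auto simp: chain_block_def)
  next
    fix p assume "p \<in> (\<Union>j\<in>{1..l}. {partial_sum m (j - 1) + 1..partial_sum m (j - 1) + (m j - a j)})"
    then obtain j where j: "j \<in> {1..l}" "p \<in> {partial_sum m (j - 1) + 1..partial_sum m (j - 1) + (m j - a j)}"
      by blast
    have ps: "partial_sum m j = partial_sum m (j - 1) + m j" using j by (intro partial_sum_pred) auto
    have pc: "p \<in> chain_block m j" using j ps by (auto simp: chain_block_def)
    have "p \<notin> {partial_sum m i - a i + 1..partial_sum m i}" if "i \<in> {1..l}" for i
    proof
      assume p: "p \<in> {partial_sum m i - a i + 1..partial_sum m i}"
      then have "p \<in> chain_block m i"
        using a[OF that] partial_sum_pred[of i m] that by (auto simp: chain_block_def)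
      then have "i = j" using bo that pc j(1) by metis
      then show False using p j(2) a[OF j(1)] ps by auto
    qed
    moreover have "p \<in> {1..n}"
      using pc j(1) partial_sum_mono[of j l m] by (auto simp: chain_block_def n')
    ultimately show "p \<in> ?A" by (auto simp: upper_set_def)
  qed
  have "image_mset (block_of m) (mset_set ?A) = word_mset l (\<lambda>j. m j - a j)"
  proof (rule multiset_eqI)
    fix k
    have "count (image_mset (block_of m) (mset_set ?A)) k = card {p \<in> ?A. block_of m p = k}"
    proof -
      have "count (image_mset (block_of m) (mset_set ?A)) k =
          (\<Sum>p\<in>block_of m -` {k} \<inter> ?A. count (mset_set ?A) p)"
        by (simp add: count_image_mset)
      also have "\<dots> = (\<Sum>p\<in>block_of m -` {k} \<inter> ?A. 1)" by (rule sum.cong) auto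
      also have "block_of m -` {k} \<inter> ?A = {p \<in> ?A. block_of m p = k}" by auto
      finally show ?thesis by simp
    qed
    also have "\<dots> = (if k \<in> {1..l} then m k - a k else 0)"
    proof (cases "k \<in> {1..l}")
      case True
      have B: "block_of m p = j" if "j \<in> {1..l}"
        "p \<in> {partial_sum m (j - 1) + 1..partial_sum m (j - 1) + (m j - a j)}" for p j
        using that partial_sum_pred[of j m] by (intro bo) (auto simp: chain_block_def)
      have "{p \<in> ?A. block_of m p = k} =
          {partial_sum m (k - 1) + 1..partial_sum m (k - 1) + (m k - a k)}"
        unfolding A using B True by blast
      then show ?thesis using True by simp
    next
      case False
      then have "{p \<in> ?A. block_of m p = k} = {}" using cb bo by fastforce
      then show ?thesis using False by (simp only: card.empty if_False)
    qed
    finally show "count (image_mset (block_of m) (mset_set ?A)) k =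
        count (word_mset l (\<lambda>j. m j - a j)) k" by (simp only: count_word_mset)
  qed
  moreover have "card (poset_derangements ?A (chains_order l m)) =
      card (deranged_words UNIV (image_mset (block_of m) (mset_set ?A)))"
    by (rule card_poset_derangements) (use 1 2 in simp_all)
  ultimately show ?thesis by (simp only:)
qed

text \<open>Functions in \<open>PiE\<close> are fixed outside \<open>{1..l}\<close>, so the
  multiplicities of the letters determine the composition.\<close>

lemma bij_betw_word_mset:
  "bij_betw (word_mset l) (PiE {1..l} (\<lambda>j. {0..m j})) (submsets {} (word_mset l m))"
  unfolding bij_betw_def
proof (intro conjI inj_onI equalityI subsetI)
  fix a b assume ab: "a \<in> PiE {1..l} (\<lambda>j. {0..m j})" "b \<in> PiE {1..l} (\<lambda>j. {0..m j})"
    "word_mset l a = word_mset l b"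
  show "a = b"
  proof (rule PiE_ext[OF ab(1,2)])
    fix j assume "j \<in> {1..l}"
    then show "a j = b j" using arg_cong[OF ab(3), of "\<lambda>M. count M j"] by (simp add: count_word_mset)
  qed
next
  fix A assume "A \<in> word_mset l ` (PiE {1..l} (\<lambda>j. {0..m j}))"
  then show "A \<in> submsets {} (word_mset l m)"
    by (force simp: submsets_def subseteq_mset_def count_word_mset PiE_def Pi_def)
next
  fix A assume "A \<in> submsets {} (word_mset l m)"
  then have le: "count A j \<le> count (word_mset l m) j" for j
    by (simp add: submsets_def subseteq_mset_def)
  have "A = word_mset l (restrict (count A) {1..l})"
  proof (rule multiset_eqI)
    show "count A j = count (word_mset l (restrict (count A) {1..l})) j" for j
      using le[of j] by (auto simp: count_word_mset)
  qed
  moreover have "restrict (count A) {1..l} \<in> PiE {1..l} (\<lambda>j. {0..m j})"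
  proof (rule restrict_PiE_iff[THEN iffD2], rule ballI)
    show "count A j \<in> {0..m j}" if "j \<in> {1..l}" for j
      using le[of j] that by (simp add: count_word_mset)
  qed
  ultimately show "A \<in> word_mset l ` (PiE {1..l} (\<lambda>j. {0..m j}))" by blast
qed

lemma size_filter_word_mset: "size (filter_mset ((<) j) (word_mset l a)) = (\<Sum>k=j+1..l. a k)"
proof (induction l)
  case (Suc l)
  have "word_mset (Suc l) a = word_mset l a + replicate_mset (a (Suc l)) (Suc l)"
    by (simp add: word_mset_def)
  moreover have "size (filter_mset ((<) j) (replicate_mset r (Suc l))) = (if j < Suc l then r else 0)" for r
    by (induction r) auto
  ultimately show ?case using Suc by auto
qed (simp add: word_mset_def)

text \<open>The normalisation of the weight operator supplies the denominators, as
  \<open>partial_sum m l - partial_sum m j\<close> is the sum of the later parts.\<close>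

lemma eig_mset_word_mset:
  "eig_mset q (\<lambda>j. x j / (q ^ (\<Sum>k=j+1..l. m k) * qint q (m j))) (word_mset l a) = eigval l m q x a"
proof -
  have "partial_sum m l - partial_sum m j = (\<Sum>k=j+1..l. m k)" if "j \<in> {1..l}" for j
  proof -
    have "partial_sum m l = partial_sum m j + (\<Sum>k=j+1..l. m k)"
      using that sum.ub_add_nat[of 1 j m "l - j"] by (simp add: partial_sum_def)
    then show ?thesis by simp
  qed
  moreover have "set_mset (word_mset l a) \<subseteq> {1..l}"
    by (auto simp: count_word_mset count_greater_zero_iff[symmetric] split: if_splits
        simp del: count_greater_zero_iff)
  ultimately show ?thesis
    unfolding eigval_def by (subst eig_mset_superset[of "{1..l}"])
      (auto simp: size_filter_word_mset count_word_mset intro!: sum.cong)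
qed

theorem theorem2p13:
  fixes l n :: nat and m :: "nat \<Rightarrow> nat" and q :: real and x :: "nat \<Rightarrow> real"
    and ws :: "nat list list"
  assumes "q \<ge> 1"
    and "\<And>j. j \<in> {1..l} \<Longrightarrow> m j > 0"
    and "(\<Sum>j=1..l. m j) = n"
    and "\<And>j. j \<in> {1..l} \<Longrightarrow> x j > 0"
    and "(\<Sum>j=1..l. x j) = 1"
    and "distinct ws" and "set ws = words l m"
  shows "char_poly (transition_matrix l m q x ws) =
    (\<Prod>a \<in> PiE {1..l} (\<lambda>j. {0..m j}).
       [:- eigval l m q x a, 1:] ^
         card (poset_derangements ({1..n} - upper_set l m a) (chains_order l m)))"
proof -
  let ?y = "\<lambda>j. x j / (q ^ (\<Sum>k=j+1..l. m k) * qint q (m j))" and ?M = "word_mset l m"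
  have "char_poly (transition_matrix l m q x ws) =
      (\<Prod>A\<in>submsets {} ?M. [:- eig_mset q ?y A, 1:] ^ card (deranged_words UNIV (?M - A)))"
    using char_poly_transition_matrix[OF assms(1,6,7)] by (simp only: ker_mult_eq[OF assms(1)])
  also have "\<dots> = (\<Prod>a \<in> PiE {1..l} (\<lambda>j. {0..m j}).
      [:- eig_mset q ?y (word_mset l a), 1:] ^ card (deranged_words UNIV (?M - word_mset l a)))"
    by (rule prod.reindex_bij_betw[OF bij_betw_word_mset, symmetric])
  also have "\<dots> = (\<Prod>a \<in> PiE {1..l} (\<lambda>j. {0..m j}). [:- eigval l m q x a, 1:] ^
      card (poset_derangements ({1..n} - upper_set l m a) (chains_order l m)))"
  proof (rule prod.cong[OF refl])
    fix a assume a: "a \<in> PiE {1..l} (\<lambda>j. {0..m j})"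
    \<comment> \<open>Removing \<open>a\<close> from the content matches deleting the upper set:
      \<open>m j - a j\<close> copies of letter \<open>j\<close>, or elements of chain
      \<open>j\<close>, remain.\<close>
    have "?M - word_mset l a = word_mset l (\<lambda>j. m j - a j)"
      by (rule multiset_eqI) (simp add: count_word_mset)
    moreover have "a j \<le> m j" if "j \<in> {1..l}" for j using PiE_mem[OF a that] by simp
    ultimately show "[:- eig_mset q ?y (word_mset l a), 1:] ^ card (deranged_words UNIV (?M - word_mset l a)) =
        [:- eigval l m q x a, 1:] ^
          card (poset_derangements ({1..n} - upper_set l m a) (chains_order l m))"
      using card_chain_derangements[of l a m n] assms(3) by (simp only: eig_mset_word_mset)
  qed
  finally show ?thesis .
qed

end
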